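(* Let $(M,J,g)$ be a Hermitian manifold with fundamental $2$-form $\Omega$ such that $H=d^c\Omega$ is non-degenerate. Suppose that $M$ has an open cover $\{U_i\}$ and a family $\{f_i\}$ of smooth functions $f_i:U_i\to\mathbb R$ such that each local $3$-form $(e^{-f_i}H)|_{U_i}$ is $d$-closed. Then $(M,J,g)$ is an LCSKT manifold.
   Context: $(M,J,g)$ is a Hermitian manifold of real dimension $2n$: $J$ is an (integrable) complex structure and $g$ a Riemannian metric with $g(JX,JY)=g(X,Y)$. The fundamental form is $\Omega(X,Y)=g(JX,Y)$ and $H=d^c\Omega$ with $d^c=i(\overline\partial-\partial)$, i.e. $H(X,Y,Z)=-d\Omega(JX,JY,JZ)$. For a differential form $\omega$ on $M$, $\ker\omega=\{X\in\Gamma(TM):\iota_X\omega=0\}$, where $\iota_X$ is the interior product; $\omega$ is non-degenerate if $\ker\omega=0$. $(M,J,g)$ is LCSKT if there exists a $d$-closed $1$-form $\alpha$ on $M$ with $dH=\alpha\wedge H$; here the SKT case $dH=0$ (with $\alpha=0$ allowed) is counted as a trivial LCSKT structure. *)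

theory Defs
  imports "HOL-Analysis.Analysis"
begin

section \<open>Smooth maps between normed spaces\<close>

text \<open>Only used for an open set \<open>S\<close> in a finite-dimensional space, where having all directional
  derivatives of class \<open>C\<^sup>k\<close> is the same as being of class \<open>C\<^bsup>k + 1\<^esup>\<close>.\<close>

fun Ck_on :: "nat \<Rightarrow> 'e::real_normed_vector set \<Rightarrow> ('e \<Rightarrow> 'f::real_normed_vector) \<Rightarrow> bool" where
  "Ck_on 0 S f \<longleftrightarrow> continuous_on S f"
| "Ck_on (Suc k) S f \<longleftrightarrow>
     f differentiable_on S \<and> (\<forall>v. Ck_on k S (\<lambda>x. frechet_derivative f (at x) v))"

definition smooth_on :: "'e::real_normed_vector set \<Rightarrow> ('e \<Rightarrow> 'f::real_normed_vector) \<Rightarrow> bool" where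
  "smooth_on S f \<longleftrightarrow> (\<forall>k. Ck_on k S f)"


section \<open>Smooth manifolds\<close>

text \<open>A chart is a pair of its domain and its coordinate map; the values of the coordinate map
  outside the domain are irrelevant.\<close>

type_synonym ('a, 'e) chart = "'a set \<times> ('a \<Rightarrow> 'e)"

definition is_chart :: "'a topology \<Rightarrow> ('a, 'e::euclidean_space) chart \<Rightarrow> bool" where
  "is_chart M c \<longleftrightarrow>
     openin M (fst c) \<and> open (snd c ` fst c) \<and>
     homeomorphic_map (subtopology M (fst c)) (top_of_set (snd c ` fst c)) (snd c)"

definition chart_inv :: "('a, 'e) chart \<Rightarrow> 'e \<Rightarrow> 'a" where
  "chart_inv c = inv_into (fst c) (snd c)"

definition transition :: "('a, 'e) chart \<Rightarrow> ('a, 'e) chart \<Rightarrow> 'e \<Rightarrow> 'e" where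
  "transition c c' = snd c' \<circ> chart_inv c"

definition compatible :: "('a, 'e::euclidean_space) chart \<Rightarrow> ('a, 'e) chart \<Rightarrow> bool" where
  "compatible c c' \<longleftrightarrow>
     smooth_on (snd c ` (fst c \<inter> fst c')) (transition c c') \<and>
     smooth_on (snd c' ` (fst c \<inter> fst c')) (transition c' c)"

text \<open>A smooth structure is given by its maximal atlas.\<close>

definition smooth_structure :: "'a topology \<Rightarrow> ('a, 'e::euclidean_space) chart set \<Rightarrow> bool" where
  "smooth_structure M A \<longleftrightarrow>
     (\<forall>c\<in>A. is_chart M c) \<and> (\<Union>c\<in>A. fst c) = topspace M \<and>
     (\<forall>c\<in>A. \<forall>c'\<in>A. compatible c c') \<and>
     (\<forall>c. is_chart M c \<and> (\<forall>c'\<in>A. compatible c c') \<longrightarrow> c \<in> A)"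

definition second_countable_space :: "'a topology \<Rightarrow> bool" where
  "second_countable_space M \<longleftrightarrow>
     (\<exists>\<B>. countable \<B> \<and> (\<forall>B\<in>\<B>. openin M B) \<and>
          (\<forall>W. openin M W \<longrightarrow> (\<exists>\<B>'\<subseteq>\<B>. \<Union>\<B>' = W)))"

definition smooth_manifold :: "'a topology \<Rightarrow> ('a, 'e::euclidean_space) chart set \<Rightarrow> bool" where
  "smooth_manifold M A \<longleftrightarrow>
     Hausdorff_space M \<and> second_countable_space M \<and> smooth_structure M A"

definition smooth_function_on ::
    "('a, 'e::euclidean_space) chart set \<Rightarrow> 'a set \<Rightarrow> ('a \<Rightarrow> real) \<Rightarrow> bool" where
  "smooth_function_on A W f \<longleftrightarrow> (\<forall>c\<in>A. smooth_on (snd c ` (fst c \<inter> W)) (f \<circ> chart_inv c))"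


section \<open>Tensor fields\<close>

text \<open>Tensor fields are given by their components in all charts, subject to the transformation law.
  A tangent vector at \<open>p\<close> is represented in a chart \<open>c\<close> around \<open>p\<close> by a coordinate vector in the
  model space, and its coordinate vector in another chart \<open>c'\<close> is obtained by applying
  \<open>tangent_transition c c' p\<close>, the Jacobian of the change of coordinates at \<open>p\<close>.
  A covariant tensor of degree \<open>k\<close> takes its \<open>k\<close> arguments as a list;
  its values on lists of other lengths, and at points outside the chart domain, are irrelevant.\<close>

definition tangent_transition ::
    "('a, 'e::euclidean_space) chart \<Rightarrow> ('a, 'e) chart \<Rightarrow> 'a \<Rightarrow> 'e \<Rightarrow> 'e" where
  "tangent_transition c c' p = frechet_derivative (transition c c') (at (snd c p))"

type_synonym ('a, 'e) vector_field = "('a, 'e) chart \<Rightarrow> 'a \<Rightarrow> 'e"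
type_synonym ('a, 'e) endo_field = "('a, 'e) chart \<Rightarrow> 'a \<Rightarrow> 'e \<Rightarrow> 'e"
type_synonym ('a, 'e) cov_tensor = "('a, 'e) chart \<Rightarrow> 'a \<Rightarrow> 'e list \<Rightarrow> real"

definition smooth_vector_field ::
    "('a, 'e::euclidean_space) chart set \<Rightarrow> ('a, 'e) vector_field \<Rightarrow> bool" where
  "smooth_vector_field A X \<longleftrightarrow>
     (\<forall>c\<in>A. \<forall>c'\<in>A. \<forall>p\<in>fst c \<inter> fst c'. X c' p = tangent_transition c c' p (X c p)) \<and>
     (\<forall>c\<in>A. smooth_on (snd c ` fst c) (\<lambda>x. X c (chart_inv c x)))"

definition smooth_endo_field ::
    "('a, 'e::euclidean_space) chart set \<Rightarrow> ('a, 'e) endo_field \<Rightarrow> bool" where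
  "smooth_endo_field A J \<longleftrightarrow>
     (\<forall>c\<in>A. \<forall>p\<in>fst c. linear (J c p)) \<and>
     (\<forall>c\<in>A. \<forall>c'\<in>A. \<forall>p\<in>fst c \<inter> fst c'. \<forall>v.
        J c' p (tangent_transition c c' p v) = tangent_transition c c' p (J c p v)) \<and>
     (\<forall>c\<in>A. \<forall>v. smooth_on (snd c ` fst c) (\<lambda>x. J c (chart_inv c x) v))"

definition smooth_cov_tensor ::
    "('a, 'e::euclidean_space) chart set \<Rightarrow> nat \<Rightarrow> ('a, 'e) cov_tensor \<Rightarrow> bool" where
  "smooth_cov_tensor A k \<omega> \<longleftrightarrow>
     (\<forall>c\<in>A. \<forall>p\<in>fst c. \<forall>vs. length vs = k \<longrightarrow> (\<forall>i<k. linear (\<lambda>v. \<omega> c p (vs[i := v])))) \<and>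
     (\<forall>c\<in>A. \<forall>c'\<in>A. \<forall>p\<in>fst c \<inter> fst c'. \<forall>vs. length vs = k \<longrightarrow>
        \<omega> c' p (map (tangent_transition c c' p) vs) = \<omega> c p vs) \<and>
     (\<forall>c\<in>A. \<forall>vs. length vs = k \<longrightarrow> smooth_on (snd c ` fst c) (\<lambda>x. \<omega> c (chart_inv c x) vs))"


section \<open>Differential forms\<close>

definition diff_form ::
    "('a, 'e::euclidean_space) chart set \<Rightarrow> nat \<Rightarrow> ('a, 'e) cov_tensor \<Rightarrow> bool" where
  "diff_form A k \<omega> \<longleftrightarrow>
     smooth_cov_tensor A k \<omega> \<and>
     (\<forall>c\<in>A. \<forall>p\<in>fst c. \<forall>vs. length vs = k \<longrightarrow>
        (\<forall>i<k. \<forall>j<k. i \<noteq> j \<and> vs ! i = vs ! j \<longrightarrow> \<omega> c p vs = 0))"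

definition form_eq_on ::
    "('a, 'e) chart set \<Rightarrow> nat \<Rightarrow> 'a set \<Rightarrow> ('a, 'e) cov_tensor \<Rightarrow> ('a, 'e) cov_tensor \<Rightarrow> bool" where
  "form_eq_on A k W \<omega> \<eta> \<longleftrightarrow>
     (\<forall>c\<in>A. \<forall>p\<in>fst c \<inter> W. \<forall>vs. length vs = k \<longrightarrow> \<omega> c p vs = \<eta> c p vs)"

definition omit :: "nat \<Rightarrow> 'b list \<Rightarrow> 'b list" where
  "omit i vs = take i vs @ drop (Suc i) vs"

text \<open>The exterior derivative in coordinates: for constant coordinate vectors, all brackets in
  the invariant formula for \<open>d\<omega>\<close> vanish, leaving
  \<open>d\<omega>(v\<^sub>0, \<dots>, v\<^sub>k) = \<Sum>i. (-1)^i v\<^sub>i(\<omega>(\<dots>, v\<^sub>i omitted, \<dots>))\<close>.\<close>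

definition ext_deriv :: "('a, 'e::euclidean_space) cov_tensor \<Rightarrow> ('a, 'e) cov_tensor" where
  "ext_deriv \<omega> = (\<lambda>c p vs. \<Sum>i<length vs.
     (-1) ^ i * frechet_derivative (\<lambda>x. \<omega> c (chart_inv c x) (omit i vs)) (at (snd c p)) (vs ! i))"

text \<open>The wedge product of a 1-form \<open>\<alpha>\<close> with a form, normalised (like \<open>ext_deriv\<close>) so that
  \<open>d(f\<omega>) = df \<and> \<omega> + f d\<omega>\<close>.\<close>

definition wedge1 :: "('a, 'e) cov_tensor \<Rightarrow> ('a, 'e) cov_tensor \<Rightarrow> ('a, 'e) cov_tensor" where
  "wedge1 \<alpha> \<omega> = (\<lambda>c p vs. \<Sum>i<length vs. (-1) ^ i * \<alpha> c p [vs ! i] * \<omega> c p (omit i vs))"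

definition scale_form :: "('a \<Rightarrow> real) \<Rightarrow> ('a, 'e) cov_tensor \<Rightarrow> ('a, 'e) cov_tensor" where
  "scale_form f \<omega> = (\<lambda>c p vs. f p * \<omega> c p vs)"

definition interior_prod ::
    "('a, 'e) vector_field \<Rightarrow> ('a, 'e) cov_tensor \<Rightarrow> ('a, 'e) cov_tensor" where
  "interior_prod X \<omega> = (\<lambda>c p vs. \<omega> c p (X c p # vs))"

text \<open>The degree-\<open>k\<close> form \<open>\<omega>\<close> restricted to the open set \<open>W\<close> is closed. Since \<open>ext_deriv\<close> at \<open>p\<close>
  only depends on \<open>\<omega>\<close> near \<open>p\<close>, it commutes with restriction to \<open>W\<close>.\<close>

definition closed_form_on ::
    "('a, 'e::euclidean_space) chart set \<Rightarrow> nat \<Rightarrow> 'a set \<Rightarrow> ('a, 'e) cov_tensor \<Rightarrow> bool" where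
  "closed_form_on A k W \<omega> \<longleftrightarrow> form_eq_on A (Suc k) W (ext_deriv \<omega>) (\<lambda>c p vs. 0)"

definition form_kernel ::
    "'a topology \<Rightarrow> ('a, 'e::euclidean_space) chart set \<Rightarrow> nat \<Rightarrow> ('a, 'e) cov_tensor
      \<Rightarrow> ('a, 'e) vector_field set" where
  "form_kernel M A k \<omega> =
     {X. smooth_vector_field A X \<and>
         form_eq_on A (k - 1) (topspace M) (interior_prod X \<omega>) (\<lambda>c p vs. 0)}"

text \<open>Non-degeneracy refers to the kernel in global smooth vector fields, not to the pointwise
  kernels.\<close>

definition nondegenerate_form ::
    "'a topology \<Rightarrow> ('a, 'e::euclidean_space) chart set \<Rightarrow> nat \<Rightarrow> ('a, 'e) cov_tensor \<Rightarrow> bool" where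
  "nondegenerate_form M A k \<omega> \<longleftrightarrow> (\<forall>X\<in>form_kernel M A k \<omega>. \<forall>c\<in>A. \<forall>p\<in>fst c. X c p = 0)"


section \<open>Hermitian manifolds\<close>

definition riemannian_metric ::
    "('a, 'e::euclidean_space) chart set \<Rightarrow> ('a, 'e) cov_tensor \<Rightarrow> bool" where
  "riemannian_metric A g \<longleftrightarrow>
     smooth_cov_tensor A 2 g \<and>
     (\<forall>c\<in>A. \<forall>p\<in>fst c. (\<forall>u v. g c p [u, v] = g c p [v, u]) \<and> (\<forall>v. v \<noteq> 0 \<longrightarrow> g c p [v, v] > 0))"

text \<open>The model space is \<open>\<complex>\<^sup>n\<close> with \<open>n = CARD('n)\<close>, regarded as a real vector space of
  dimension \<open>2n\<close>. Integrability of the almost complex structure \<open>J\<close> means that around every point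
  there are holomorphic coordinates, i.e. a chart of the smooth structure
  in which \<open>J\<close> is multiplication by \<open>\<i>\<close>.\<close>

definition complex_structure ::
    "'a topology \<Rightarrow> ('a, complex ^ 'n) chart set \<Rightarrow> ('a, complex ^ 'n) endo_field \<Rightarrow> bool" where
  "complex_structure M A J \<longleftrightarrow>
     smooth_endo_field A J \<and>
     (\<forall>c\<in>A. \<forall>p\<in>fst c. \<forall>v. J c p (J c p v) = - v) \<and>
     (\<forall>p\<in>topspace M. \<exists>c\<in>A. p \<in> fst c \<and> (\<forall>q\<in>fst c. \<forall>v. J c q v = \<i> *s v))"

definition hermitian_manifold ::
    "'a topology \<Rightarrow> ('a, complex ^ 'n) chart set \<Rightarrow> ('a, complex ^ 'n) endo_field
      \<Rightarrow> ('a, complex ^ 'n) cov_tensor \<Rightarrow> bool" where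
  "hermitian_manifold M A J g \<longleftrightarrow>
     smooth_manifold M A \<and> complex_structure M A J \<and> riemannian_metric A g \<and>
     (\<forall>c\<in>A. \<forall>p\<in>fst c. \<forall>u v. g c p [J c p u, J c p v] = g c p [u, v])"

definition fundamental_form ::
    "('a, 'e) endo_field \<Rightarrow> ('a, 'e) cov_tensor \<Rightarrow> ('a, 'e) cov_tensor" where
  "fundamental_form J g = (\<lambda>c p vs. g c p [J c p (vs ! 0), vs ! 1])"

text \<open>\<open>H = d\<^sup>c\<Omega>\<close> with \<open>d\<^sup>c = \<i> (\<partial>-bar - \<partial>)\<close>. As \<open>\<Omega>\<close> is of type (1,1), \<open>d\<Omega>\<close> is the sum of its
  (2,1)-part \<open>\<partial>\<Omega>\<close> and its (1,2)-part \<open>\<partial>-bar \<Omega>\<close>; precomposing all arguments with \<open>J\<close> multiplies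
  these by \<open>\<i>\<close> and \<open>-\<i>\<close>, whence \<open>H(X, Y, Z) = - d\<Omega>(JX, JY, JZ)\<close>.\<close>

definition torsion_form ::
    "('a, 'e::euclidean_space) endo_field \<Rightarrow> ('a, 'e) cov_tensor \<Rightarrow> ('a, 'e) cov_tensor" where
  "torsion_form J g = (\<lambda>c p vs. - ext_deriv (fundamental_form J g) c p (map (J c p) vs))"

definition LCSKT ::
    "'a topology \<Rightarrow> ('a, complex ^ 'n) chart set \<Rightarrow> ('a, complex ^ 'n) endo_field
      \<Rightarrow> ('a, complex ^ 'n) cov_tensor \<Rightarrow> bool" where
  "LCSKT M A J g \<longleftrightarrow>
     hermitian_manifold M A J g \<and>
     (\<exists>\<alpha>. diff_form A 1 \<alpha> \<and> closed_form_on A 1 (topspace M) \<alpha> \<and>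
        form_eq_on A 4 (topspace M)
          (ext_deriv (torsion_form J g)) (wedge1 \<alpha> (torsion_form J g)))"

end

theory Submission
  imports Defs
begin

text \<open>
  The Leibniz rule gives \<open>d(e\<^sup>-\<^sup>f H) = e\<^sup>-\<^sup>f (dH - df \<and> H)\<close>. Hence \<open>dH = df\<^sub>i \<and> H\<close> on \<open>U\<^sub>i\<close>
  (\<open>ext_deriv_eq_wedge1_differential\<close>), and the theorem follows if the local differentials
  \<open>df\<^sub>i\<close> agree on overlaps: they then glue to a global 1-form \<open>\<alpha>\<close>, which is closed because it is
  locally exact (\<open>glued_differentials_closed_form\<close>), and \<open>dH = \<alpha> \<and> H\<close>.

  On \<open>U\<^sub>i \<inter> U\<^sub>j\<close> the difference \<open>\<beta> = df\<^sub>i - df\<^sub>j\<close> satisfies \<open>\<beta> \<and> H = 0\<close>. Suppose that \<open>\<beta>\<close> does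
  not vanish at some point; then it has no zeros in a neighbourhood. There \<open>H = \<beta> \<and> \<gamma>\<close> for a
  2-form \<open>\<gamma>\<close>, and \<open>\<gamma>\<close> restricted to the odd-dimensional space \<open>ker \<beta>\<close> is a skew form, hence
  degenerate. A vector in its radical is annihilated by \<open>H\<close>
  (\<open>degenerate_3form_if_divisible\<close>).

  Non-degeneracy of \<open>H\<close> only excludes kernel vectors that form a global smooth vector field.
  So the pointwise kernel vectors have to be replaced by a smooth field on some smaller open set,
  which is done by Gaussian elimination without divisions (\<open>smooth_linear_dependence\<close>),
  and this field is multiplied by a bump function and extended by zero
  (\<open>smooth_vector_field_extend_by_zero\<close>). The result is a non-zero element of the kernel of
  \<open>H\<close> (\<open>torsion_form_kernel_field\<close>), a contradiction. Membership in the kernel concerns all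
  charts, and passing between them requires that \<open>d\<Omega>\<close> transforms like a tensor, that is, that
  \<open>d\<close> commutes with pullback of 2-forms (\<open>ext_deriv2_pullback\<close>).
\<close>

section \<open>Calculus of smooth maps\<close>

lemma Ck_on_Suc_imp_Ck_on:
  assumes "Ck_on (Suc k) S f"
  shows "Ck_on k S f"
  using assms
  by (induction k arbitrary: f) (auto intro: differentiable_imp_continuous_on)

lemma Ck_on_subset:
  assumes "Ck_on k S f" "T \<subseteq> S"
  shows "Ck_on k T f"
  using assms
  by (induction k arbitrary: f) (auto intro: continuous_on_subset differentiable_on_subset)

lemma Ck_on_cong:
  assumes "open S" "Ck_on k S f" "\<And>x. x \<in> S \<Longrightarrow> f x = g x"
  shows "Ck_on k S g"
  using assms(2,3)
proof (induction k arbitrary: f g)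
  case 0
  then show ?case using continuous_on_cong[of S S f g] by simp
next
  case (Suc k)
  have diff: "f differentiable at x" if "x \<in> S" for x
    using Suc.prems(1) that by (simp add: differentiable_on_eq_differentiable_at assms(1))
  have D: "(g has_derivative frechet_derivative f (at x)) (at x)" if "x \<in> S" for x
    using has_derivative_transform_within_open[OF _ assms(1) that Suc.prems(2)]
      diff[OF that] by (simp add: frechet_derivative_works)
  have "frechet_derivative f (at x) = frechet_derivative g (at x)" if "x \<in> S" for x
    using D[OF that] by (rule frechet_derivative_at)
  then have "Ck_on k S (\<lambda>x. frechet_derivative g (at x) v)" for v
    using Suc.IH[of "\<lambda>x. frechet_derivative f (at x) v"] Suc.prems(1) by simp
  moreover have "g differentiable_on S"
    using D by (auto simp: differentiable_on_eq_differentiable_at[OF assms(1)] differentiable_def)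
  ultimately show ?case by simp
qed

lemma Ck_on_imp_has_derivative:
  assumes "Ck_on (Suc k) S f" "open S" "x \<in> S"
  shows "(f has_derivative frechet_derivative f (at x)) (at x)"
  using assms by (simp add: differentiable_on_eq_differentiable_at frechet_derivative_works)

lemma frechet_derivative_apply:
  "(f has_derivative F) (at x) \<Longrightarrow> frechet_derivative f (at x) v = F v"
  by (simp add: frechet_derivative_at[symmetric])

lemma Ck_on_SucI:
  assumes "open S" "\<And>x. x \<in> S \<Longrightarrow> (f has_derivative F x) (at x)"
    and "\<And>v. Ck_on k S (\<lambda>x. F x v)"
  shows "Ck_on (Suc k) S f"
proof -
  have "F x = frechet_derivative f (at x)" if "x \<in> S" for x
    using assms(2)[OF that] by (rule frechet_derivative_at)
  then have "Ck_on k S (\<lambda>x. frechet_derivative f (at x) v)" for v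
    by (intro Ck_on_cong[OF assms(1) assms(3)[of v]]) simp
  moreover have "f differentiable_on S"
    using assms(2) by (auto simp: differentiable_on_eq_differentiable_at[OF assms(1)] differentiable_def)
  ultimately show ?thesis by simp
qed

lemma Ck_on_local:
  assumes "open S" "\<And>x. x \<in> S \<Longrightarrow> \<exists>T. open T \<and> x \<in> T \<and> Ck_on k T f"
  shows "Ck_on k S f"
  using assms(2)
proof (induction k arbitrary: f)
  case 0
  then have "isCont f x" if "x \<in> S" for x
    using that by (metis Ck_on.simps(1) continuous_on_eq_continuous_at)
  then show ?case by (simp add: continuous_at_imp_continuous_on)
next
  case (Suc k)
  have "f differentiable at x" if "x \<in> S" for x
    using Suc.prems[OF that] by (auto simp: differentiable_on_eq_differentiable_at)
  moreover have "Ck_on k S (\<lambda>x. frechet_derivative f (at x) v)" for v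
    by (rule Suc.IH) (use Suc.prems in fastforce)
  ultimately show ?case by (simp add: differentiable_on_eq_differentiable_at assms(1))
qed

lemma Ck_on_const: "open S \<Longrightarrow> Ck_on k S (\<lambda>x. c)"
proof (induction k arbitrary: c)
  case (Suc k)
  show ?case by (rule Ck_on_SucI[where F = "\<lambda>_ _. 0"]) (use Suc in auto)
qed simp

lemma Ck_on_add:
  assumes "open S" "Ck_on k S f" "Ck_on k S g"
  shows "Ck_on k S (\<lambda>x. f x + g x)"
  using assms(2,3)
proof (induction k arbitrary: f g)
  case (Suc k)
  show ?case
    using Suc.prems Suc.prems[THEN Ck_on_imp_has_derivative, OF assms(1)]
    by (intro Ck_on_SucI[OF assms(1) has_derivative_add] Suc.IH) auto
qed (simp add: continuous_on_add)

lemma Ck_on_bounded_linear: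
  assumes "open S" "bounded_linear h" "Ck_on k S f"
  shows "Ck_on k S (\<lambda>x. h (f x))"
  using assms(3)
proof (induction k arbitrary: f)
  case 0
  then show ?case
    by (simp add: bounded_linear.continuous_on[OF assms(2)])
next
  case (Suc k)
  show ?case
    using Suc.prems Suc.prems[THEN Ck_on_imp_has_derivative, OF assms(1)]
    by (intro Ck_on_SucI[OF assms(1) bounded_linear.has_derivative[OF assms(2)]] Suc.IH) auto
qed

lemma Ck_on_scaleR:
  fixes r :: "'e::real_normed_vector \<Rightarrow> real"
  assumes "open S" "Ck_on k S r" "Ck_on k S f"
  shows "Ck_on k S (\<lambda>x. r x *\<^sub>R f x)"
  using assms(2,3)
proof (induction k arbitrary: r f)
  case (Suc k)
  have "Ck_on k S r" "Ck_on k S f"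
    using Suc.prems by (blast intro: Ck_on_Suc_imp_Ck_on)+
  moreover have "Ck_on k S (\<lambda>x. frechet_derivative r (at x) v)"
      "Ck_on k S (\<lambda>x. frechet_derivative f (at x) v)" for v
    using Suc.prems by simp_all
  ultimately show ?case
    using Suc.prems[THEN Ck_on_imp_has_derivative, OF assms(1)]
    by (intro Ck_on_SucI[OF assms(1) has_derivative_scaleR] Ck_on_add[OF assms(1)] Suc.IH)
qed (simp add: continuous_on_scaleR)

lemma Ck_on_sum:
  assumes "open S" "\<And>i. i \<in> I \<Longrightarrow> Ck_on k S (f i)"
  shows "Ck_on k S (\<lambda>x. \<Sum>i\<in>I. f i x)"
  using assms(2)
  by (induction I rule: infinite_finite_induct)
     (auto intro!: Ck_on_const Ck_on_add assms(1))

lemma linear_eq_sum_Basis: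
  fixes T :: "'e::euclidean_space \<Rightarrow> 'f::real_vector"
  assumes "linear T"
  shows "T v = (\<Sum>b\<in>Basis. (v \<bullet> b) *\<^sub>R T b)"
proof -
  have "T v = T (\<Sum>b\<in>Basis. (v \<bullet> b) *\<^sub>R b)" by (simp add: euclidean_representation)
  also have "\<dots> = (\<Sum>b\<in>Basis. (v \<bullet> b) *\<^sub>R T b)"
    by (simp add: linear_sum[OF assms] linear_cmul[OF assms])
  finally show ?thesis .
qed

text \<open>Expanding the chain rule in a basis of the intermediate space turns the derivative of the
  composition into a sum of products \<open>(Dh(x)v \<bullet> b) Df(h(x))b\<close>, whose factors are of class
  \<open>C\<^sup>k\<close>: the second one is again a composition, to which the induction hypothesis applies.\<close>

lemma Ck_on_compose:
  fixes f :: "'f::euclidean_space \<Rightarrow> 'g::real_normed_vector"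
    and h :: "'e::real_normed_vector \<Rightarrow> 'f"
  assumes "open S" "open T" "h ` S \<subseteq> T" "Ck_on k S h" "Ck_on k T f"
  shows "Ck_on k S (\<lambda>x. f (h x))"
  using assms(4,5)
proof (induction k arbitrary: f)
  case 0
  then show ?case
    using continuous_on_compose2[of T f S h] assms(3) by simp
next
  case (Suc k)
  let ?Dh = "\<lambda>x. frechet_derivative h (at x)" and ?Df = "\<lambda>x. frechet_derivative f (at x)"
  let ?F = "\<lambda>x v. \<Sum>b\<in>Basis. (?Dh x v \<bullet> b) *\<^sub>R ?Df (h x) b"
  have "((\<lambda>x. f (h x)) has_derivative ?F x) (at x)" if x: "x \<in> S" for x
  proof -
    have f: "(f has_derivative ?Df (h x)) (at (h x))"
      using assms(3) x by (intro Ck_on_imp_has_derivative[OF Suc.prems(2) assms(2)]) auto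
    have h: "(h has_derivative ?Dh x) (at x)"
      using Ck_on_imp_has_derivative[OF Suc.prems(1) assms(1) x] .
    have "?F x = (\<lambda>v. ?Df (h x) (?Dh x v))"
      by (rule ext, rule linear_eq_sum_Basis[OF has_derivative_linear[OF f], symmetric])
    then show ?thesis
      using has_derivative_compose[OF h f] by (simp only:)
  qed
  moreover have "Ck_on k S (\<lambda>x. ?F x v)" for v
  proof (intro Ck_on_sum Ck_on_scaleR assms(1))
    show "Ck_on k S (\<lambda>x. ?Dh x v \<bullet> b)" for b
      using Suc.prems(1) by (intro Ck_on_bounded_linear[OF assms(1) bounded_linear_inner_left]) simp
    show "Ck_on k S (\<lambda>x. ?Df (h x) b)" for b
      by (intro Suc.IH[of "\<lambda>y. ?Df y b"]) (use Suc.prems Ck_on_Suc_imp_Ck_on in auto)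
  qed
  ultimately show ?case by (intro Ck_on_SucI[OF assms(1)])
qed

lemma smooth_on_subset: "smooth_on S f \<Longrightarrow> T \<subseteq> S \<Longrightarrow> smooth_on T f"
  by (auto simp: smooth_on_def intro: Ck_on_subset)

lemma smooth_on_cong:
  "open S \<Longrightarrow> smooth_on S f \<Longrightarrow> (\<And>x. x \<in> S \<Longrightarrow> f x = g x) \<Longrightarrow> smooth_on S g"
  unfolding smooth_on_def by (metis Ck_on_cong)

lemma smooth_on_local:
  "open S \<Longrightarrow> (\<And>x. x \<in> S \<Longrightarrow> \<exists>T. open T \<and> x \<in> T \<and> smooth_on T f) \<Longrightarrow> smooth_on S f"
  unfolding smooth_on_def by (metis (no_types, lifting) Ck_on_local)

lemma smooth_on_const: "open S \<Longrightarrow> smooth_on S (\<lambda>x. c)"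
  by (simp add: smooth_on_def Ck_on_const)

lemma smooth_on_add:
  "open S \<Longrightarrow> smooth_on S f \<Longrightarrow> smooth_on S g \<Longrightarrow> smooth_on S (\<lambda>x. f x + g x)"
  by (simp add: smooth_on_def Ck_on_add)

lemma smooth_on_bounded_linear:
  "open S \<Longrightarrow> bounded_linear h \<Longrightarrow> smooth_on S f \<Longrightarrow> smooth_on S (\<lambda>x. h (f x))"
  by (simp add: smooth_on_def Ck_on_bounded_linear)

lemma smooth_on_inner_left:
  "open S \<Longrightarrow> smooth_on S f \<Longrightarrow> smooth_on S (\<lambda>x. f x \<bullet> b)"
  by (rule smooth_on_bounded_linear[OF _ bounded_linear_inner_left])

lemma smooth_on_scaleR:
  fixes r :: "'e::real_normed_vector \<Rightarrow> real"
  shows "open S \<Longrightarrow> smooth_on S r \<Longrightarrow> smooth_on S f \<Longrightarrow> smooth_on S (\<lambda>x. r x *\<^sub>R f x)"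
  by (simp add: smooth_on_def Ck_on_scaleR)

lemma smooth_on_mult:
  fixes r :: "'e::real_normed_vector \<Rightarrow> real"
  shows "open S \<Longrightarrow> smooth_on S r \<Longrightarrow> smooth_on S f \<Longrightarrow> smooth_on S (\<lambda>x. r x * f x)"
  using smooth_on_scaleR[of S r f] by simp

lemma smooth_on_minus:
  "open S \<Longrightarrow> smooth_on S f \<Longrightarrow> smooth_on S (\<lambda>x. - f x)"
  by (rule smooth_on_bounded_linear[OF _ bounded_linear_minus[OF bounded_linear_ident]])

lemma smooth_on_diff:
  "open S \<Longrightarrow> smooth_on S f \<Longrightarrow> smooth_on S g \<Longrightarrow> smooth_on S (\<lambda>x. f x - g x)"
  using smooth_on_add[OF _ _ smooth_on_minus, of S f g] by simp

lemma smooth_on_sum: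
  "open S \<Longrightarrow> (\<And>i. i \<in> I \<Longrightarrow> smooth_on S (f i)) \<Longrightarrow> smooth_on S (\<lambda>x. \<Sum>i\<in>I. f i x)"
  by (simp add: smooth_on_def Ck_on_sum)

lemma smooth_on_compose:
  fixes f :: "'f::euclidean_space \<Rightarrow> 'g::real_normed_vector"
    and h :: "'e::real_normed_vector \<Rightarrow> 'f"
  shows "open S \<Longrightarrow> open T \<Longrightarrow> h ` S \<subseteq> T \<Longrightarrow> smooth_on S h \<Longrightarrow> smooth_on T f
    \<Longrightarrow> smooth_on S (\<lambda>x. f (h x))"
  by (simp add: smooth_on_def Ck_on_compose)

lemma smooth_onI_derivative:
  assumes "open S" "\<And>x. x \<in> S \<Longrightarrow> (f has_derivative F x) (at x)"
    and "\<And>v. smooth_on S (\<lambda>x. F x v)"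
  shows "smooth_on S f"
proof -
  have "Ck_on (Suc k) S f" for k
    using assms by (intro Ck_on_SucI) (auto simp: smooth_on_def)
  then show ?thesis
    unfolding smooth_on_def by (blast intro: Ck_on_Suc_imp_Ck_on)
qed

lemma smooth_on_ident: "open S \<Longrightarrow> smooth_on S (\<lambda>x. x)"
  by (rule smooth_onI_derivative[where F = "\<lambda>x v. v"])
     (auto intro: smooth_on_const has_derivative_ident)

lemma smooth_on_imp_has_derivative:
  "smooth_on S f \<Longrightarrow> open S \<Longrightarrow> x \<in> S
    \<Longrightarrow> (f has_derivative frechet_derivative f (at x)) (at x)"
  unfolding smooth_on_def by (blast intro: Ck_on_imp_has_derivative)

lemma smooth_on_imp_continuous_on: "smooth_on S f \<Longrightarrow> continuous_on S f"
  unfolding smooth_on_def by (metis Ck_on.simps(1))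

lemma smooth_on_frechet_derivative:
  assumes "smooth_on S f"
  shows "smooth_on S (\<lambda>x. frechet_derivative f (at x) v)"
  unfolding smooth_on_def
proof
  fix k
  have "Ck_on (Suc k) S f" using assms by (simp add: smooth_on_def)
  then show "Ck_on k S (\<lambda>x. frechet_derivative f (at x) v)" by simp
qed

text \<open>Expanding the moving argument in a basis leaves constant arguments with smooth
  coefficients. Smoothness of a tensor field is defined through constant coordinate vectors, and
  in this way it extends to arguments that are smooth vector fields.\<close>

lemma smooth_on_linear_apply:
  fixes T :: "'e::real_normed_vector \<Rightarrow> 'f::euclidean_space \<Rightarrow> 'g::real_normed_vector"
  assumes "open S" "\<And>x. x \<in> S \<Longrightarrow> linear (T x)" "\<And>b. smooth_on S (\<lambda>x. T x b)"
    and "smooth_on S v"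
  shows "smooth_on S (\<lambda>x. T x (v x))"
proof (rule smooth_on_cong[OF assms(1)])
  show "smooth_on S (\<lambda>x. \<Sum>b\<in>Basis. (v x \<bullet> b) *\<^sub>R T x b)"
    by (intro smooth_on_sum smooth_on_scaleR smooth_on_inner_left assms)
  show "(\<Sum>b\<in>Basis. (v x \<bullet> b) *\<^sub>R T x b) = T x (v x)" if "x \<in> S" for x
    by (rule linear_eq_sum_Basis[OF assms(2)[OF that], symmetric])
qed

section \<open>Symmetry of second derivatives\<close>

text \<open>Applying the mean value theorem twice to the second difference
  \<open>f(x + hv + hw) - f(x + hv) - f(x + hw) + f(x)\<close>, first in the direction \<open>v\<close> and then in
  the direction \<open>w\<close>, shows that it is \<open>h\<^sup>2\<close> times a value of \<open>D\<^sub>w D\<^sub>v f\<close> near \<open>x\<close>.\<close>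

lemma second_difference_eq_mixed_derivative:
  fixes f :: "'e::real_normed_vector \<Rightarrow> real"
  assumes S: "smooth_on S f" "open S" and h: "h > 0"
    and sub: "\<And>s t. 0 \<le> s \<Longrightarrow> s \<le> h \<Longrightarrow> 0 \<le> t \<Longrightarrow> t \<le> h \<Longrightarrow> x + s *\<^sub>R v + t *\<^sub>R w \<in> S"
  obtains s t where "0 < s" "s < h" "0 < t" "t < h"
    "f (x + h *\<^sub>R v + h *\<^sub>R w) - f (x + h *\<^sub>R v) - f (x + h *\<^sub>R w) + f x =
      h * h * frechet_derivative (\<lambda>y. frechet_derivative f (at y) v) (at (x + s *\<^sub>R v + t *\<^sub>R w)) w"
proof -
  let ?D = "\<lambda>y. frechet_derivative f (at y) v"
  have line: "((\<lambda>s. F (a + s *\<^sub>R u)) has_derivative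
      (\<lambda>r. r * frechet_derivative F (at (a + s *\<^sub>R u)) u)) (at s within T)"
    if F: "smooth_on S F" "a + s *\<^sub>R u \<in> S" for F :: "'e \<Rightarrow> real" and a u s T
  proof -
    have D: "(F has_derivative frechet_derivative F (at (a + s *\<^sub>R u))) (at (a + s *\<^sub>R u))"
      using smooth_on_imp_has_derivative[OF F(1) S(2) F(2)] .
    have "((\<lambda>s. a + s *\<^sub>R u) has_derivative (\<lambda>r. r *\<^sub>R u)) (at s)"
      by (auto intro!: derivative_eq_intros)
    from has_derivative_compose[OF this D]
    have "((\<lambda>s. F (a + s *\<^sub>R u)) has_derivative
      (\<lambda>r. r * frechet_derivative F (at (a + s *\<^sub>R u)) u)) (at s)"
      using linear_cmul[OF has_derivative_linear[OF D]] by simp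
    then show ?thesis by (rule has_derivative_at_withinI)
  qed
  define \<phi> where "\<phi> s = f ((x + h *\<^sub>R w) + s *\<^sub>R v) - f (x + s *\<^sub>R v)" for s
  have "\<exists>s\<in>{0<..<h}. \<phi> h - \<phi> 0 = (h - 0) * (?D ((x + h *\<^sub>R w) + s *\<^sub>R v) - ?D (x + s *\<^sub>R v))"
  proof (rule mvt_simple[OF h, where f' = "\<lambda>s r. r * (?D ((x + h *\<^sub>R w) + s *\<^sub>R v) - ?D (x + s *\<^sub>R v))"])
    fix s assume "0 \<le> s" "s \<le> h"
    then have "(x + h *\<^sub>R w) + s *\<^sub>R v \<in> S" "x + s *\<^sub>R v \<in> S"
      using sub[of s h] sub[of s 0] h by (auto simp: algebra_simps)
    then show "(\<phi> has_derivative (\<lambda>r. r * (?D ((x + h *\<^sub>R w) + s *\<^sub>R v) - ?D (x + s *\<^sub>R v))))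
        (at s within {0..h})"
      unfolding \<phi>_def right_diff_distrib by (intro has_derivative_diff line S)
  qed
  then obtain s where s: "0 < s" "s < h"
    "\<phi> h - \<phi> 0 = h * (?D ((x + s *\<^sub>R v) + h *\<^sub>R w) - ?D ((x + s *\<^sub>R v) + 0 *\<^sub>R w))"
    by (auto simp: algebra_simps)
  define \<psi> where "\<psi> t = ?D ((x + s *\<^sub>R v) + t *\<^sub>R w)" for t
  have "\<exists>t\<in>{0<..<h}. \<psi> h - \<psi> 0 = (h - 0) * frechet_derivative ?D (at ((x + s *\<^sub>R v) + t *\<^sub>R w)) w"
  proof (rule mvt_simple[OF h, where f' = "\<lambda>t r. r * frechet_derivative ?D (at ((x + s *\<^sub>R v) + t *\<^sub>R w)) w"])
    fix t assume "0 \<le> t" "t \<le> h"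
    then show "(\<psi> has_derivative (\<lambda>r. r * frechet_derivative ?D (at ((x + s *\<^sub>R v) + t *\<^sub>R w)) w))
        (at t within {0..h})"
      unfolding \<psi>_def using sub[of s t] s
      by (intro line smooth_on_frechet_derivative[OF S(1)]) auto
  qed
  then obtain t where t: "0 < t" "t < h"
    "\<psi> h - \<psi> 0 = h * frechet_derivative ?D (at ((x + s *\<^sub>R v) + t *\<^sub>R w)) w"
    by auto
  show thesis
    using s t by (intro that[of s t]) (auto simp: \<phi>_def \<psi>_def algebra_simps)
qed

text \<open>The second difference is symmetric in \<open>v\<close> and \<open>w\<close>, so both mixed derivatives take a
  common value at points arbitrarily close to \<open>x\<close>; continuity does the rest.\<close>

lemma real_second_derivative_symmetric:
  fixes f :: "'e::real_normed_vector \<Rightarrow> real"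
  assumes S: "smooth_on S f" "open S" "x \<in> S"
  shows "frechet_derivative (\<lambda>y. frechet_derivative f (at y) v) (at x) w =
         frechet_derivative (\<lambda>y. frechet_derivative f (at y) w) (at x) v" (is "?A x = ?B x")
proof (rule ccontr)
  assume ne: "?A x \<noteq> ?B x"
  define \<epsilon> where "\<epsilon> = \<bar>?A x - ?B x\<bar> / 2"
  have \<epsilon>: "\<epsilon> > 0" using ne by (simp add: \<epsilon>_def)
  have "continuous_on S ?A" "continuous_on S ?B"
    by (intro smooth_on_imp_continuous_on smooth_on_frechet_derivative S)+
  then have "isCont ?A x" "isCont ?B x"
    using S continuous_on_eq_continuous_at by blast+
  then obtain d1 d2 where d1: "d1 > 0" "\<And>y. dist y x < d1 \<Longrightarrow> dist (?A y) (?A x) < \<epsilon>"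
    and d2: "d2 > 0" "\<And>y. dist y x < d2 \<Longrightarrow> dist (?B y) (?B x) < \<epsilon>"
    using \<epsilon> unfolding continuous_at_eps_delta by metis
  obtain d3 where d3: "d3 > 0" "ball x d3 \<subseteq> S"
    using S openE by metis
  define d where "d = min d1 (min d2 d3)"
  have d: "d > 0" using d1 d2 d3 by (simp add: d_def)
  \<comment> \<open>with this \<open>h\<close> the whole parallelogram spanned by \<open>hv\<close> and \<open>hw\<close> at \<open>x\<close> has distance
    less than \<open>d\<close> from \<open>x\<close>\<close>
  define h where "h = d / (2 * (norm v + norm w + 1))"
  have N: "norm v + norm w + 1 > 0"
    by (intro add_nonneg_pos add_nonneg_nonneg) auto
  have h: "h > 0" using d N by (simp add: h_def)
  have near: "dist (x + s *\<^sub>R v + t *\<^sub>R w) x < d" if "0 \<le> s" "s \<le> h" "0 \<le> t" "t \<le> h" for s t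
  proof -
    have "dist (x + s *\<^sub>R v + t *\<^sub>R w) x = norm (s *\<^sub>R v + t *\<^sub>R w)" by (simp add: dist_norm)
    also have "\<dots> \<le> s * norm v + t * norm w"
      using norm_triangle_ineq[of "s *\<^sub>R v" "t *\<^sub>R w"] that by simp
    also have "\<dots> \<le> h * norm v + h * norm w"
      using that by (intro add_mono mult_right_mono) auto
    also have "\<dots> \<le> h * (norm v + norm w + 1)" using h by (simp add: algebra_simps)
    also have "\<dots> = d / 2"
      using N by (simp only: h_def times_divide_eq_left mult.commute[of 2] divide_divide_eq_left[symmetric])
         simp
    also have "\<dots> < d" using d by simp
    finally show ?thesis .
  qed
  have sub: "x + s *\<^sub>R v + t *\<^sub>R w \<in> S" if "0 \<le> s" "s \<le> h" "0 \<le> t" "t \<le> h" for s t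
    using near[OF that] d3 by (auto simp: d_def dist_commute mem_ball subset_iff)
  obtain s t where st: "0 < s" "s < h" "0 < t" "t < h"
    "f (x + h *\<^sub>R v + h *\<^sub>R w) - f (x + h *\<^sub>R v) - f (x + h *\<^sub>R w) + f x =
      h * h * ?A (x + s *\<^sub>R v + t *\<^sub>R w)"
    using second_difference_eq_mixed_derivative[OF S(1,2) h sub] by blast
  have sub': "x + s *\<^sub>R w + t *\<^sub>R v \<in> S" if "0 \<le> s" "s \<le> h" "0 \<le> t" "t \<le> h" for s t
    using sub[of t s] that by (simp add: algebra_simps)
  obtain s' t' where st': "0 < s'" "s' < h" "0 < t'" "t' < h"
    "f (x + h *\<^sub>R w + h *\<^sub>R v) - f (x + h *\<^sub>R w) - f (x + h *\<^sub>R v) + f x =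
      h * h * ?B (x + s' *\<^sub>R w + t' *\<^sub>R v)"
    using second_difference_eq_mixed_derivative[OF S(1,2) h sub'] by blast
  have "h * h * ?A (x + s *\<^sub>R v + t *\<^sub>R w) = h * h * ?B (x + s' *\<^sub>R w + t' *\<^sub>R v)"
    unfolding st(5)[symmetric] st'(5)[symmetric] by (simp add: add.commute add.left_commute)
  then have "?A (x + s *\<^sub>R v + t *\<^sub>R w) = ?B (x + s' *\<^sub>R w + t' *\<^sub>R v)"
    using h by simp
  moreover have "dist (?A (x + s *\<^sub>R v + t *\<^sub>R w)) (?A x) < \<epsilon>"
    using near[of s t] st by (intro d1(2)) (auto simp: d_def)
  moreover have "dist (?B (x + s' *\<^sub>R w + t' *\<^sub>R v)) (?B x) < \<epsilon>"
    using near[of t' s'] st' by (intro d2(2)) (auto simp: d_def algebra_simps)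
  ultimately have "\<bar>?A x - ?B x\<bar> < 2 * \<epsilon>"
    by (simp add: dist_real_def)
  then show False by (simp add: \<epsilon>_def)
qed

lemma second_derivative_symmetric:
  fixes f :: "'e::real_normed_vector \<Rightarrow> 'f::euclidean_space"
  assumes S: "smooth_on S f" "open S" "x \<in> S"
  shows "frechet_derivative (\<lambda>y. frechet_derivative f (at y) v) (at x) w =
         frechet_derivative (\<lambda>y. frechet_derivative f (at y) w) (at x) v"
proof (rule euclidean_eqI)
  fix b :: 'f
  have comp: "frechet_derivative (\<lambda>y. F y \<bullet> b) (at y) u = frechet_derivative F (at y) u \<bullet> b"
    if "smooth_on S F" "y \<in> S" for F :: "'e \<Rightarrow> 'f" and y u
    using smooth_on_imp_has_derivative[OF that(1) S(2) that(2)]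
    by (metis has_derivative_inner_left frechet_derivative_at)
  have D: "frechet_derivative (\<lambda>y. frechet_derivative f (at y) v) (at x) w \<bullet> b =
      frechet_derivative (\<lambda>y. frechet_derivative (\<lambda>y. f y \<bullet> b) (at y) v) (at x) w" for v w
  proof -
    have "((\<lambda>y. frechet_derivative f (at y) v \<bullet> b) has_derivative
        (\<lambda>w. frechet_derivative (\<lambda>y. frechet_derivative f (at y) v) (at x) w \<bullet> b)) (at x)"
      by (intro has_derivative_inner_left smooth_on_imp_has_derivative[OF _ S(2,3)]
          smooth_on_frechet_derivative S)
    then have "((\<lambda>y. frechet_derivative (\<lambda>y. f y \<bullet> b) (at y) v) has_derivative
        (\<lambda>w. frechet_derivative (\<lambda>y. frechet_derivative f (at y) v) (at x) w \<bullet> b)) (at x)"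
      by (rule has_derivative_transform_within_open[OF _ S(2,3)]) (simp add: comp S)
    then show ?thesis by (rule frechet_derivative_apply[symmetric])
  qed
  show "frechet_derivative (\<lambda>y. frechet_derivative f (at y) v) (at x) w \<bullet> b =
      frechet_derivative (\<lambda>y. frechet_derivative f (at y) w) (at x) v \<bullet> b"
    unfolding D
    by (rule real_second_derivative_symmetric[OF smooth_on_inner_left[OF S(2,1)] S(2,3)])
qed

section \<open>A smooth bump function\<close>

text \<open>The case \<open>m = 0\<close> is the standard flat function. The factor \<open>t\<^sup>-\<^sup>m\<close> is there because the
  span of the whole family is closed under differentiation, which makes the induction for
  smoothness go through.\<close>

definition flat_exp :: "nat \<Rightarrow> real \<Rightarrow> real" where
  "flat_exp m t = (if t > 0 then exp (- inverse t) * inverse t ^ m else 0)"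

lemma flat_exp_tendsto_0: "(flat_exp m \<longlongrightarrow> 0) (at 0)"
proof -
  have "((\<lambda>t. exp (- inverse t) * inverse t ^ m) \<longlongrightarrow> 0) (at_right (0::real))"
  proof -
    have "((\<lambda>s::real. s ^ m / exp s) \<longlongrightarrow> 0) at_top"
      by (rule tendsto_power_div_exp_0)
    from filterlim_compose[OF this filterlim_inverse_at_top_right]
    have "((\<lambda>t::real. inverse t ^ m / exp (inverse t)) \<longlongrightarrow> 0) (at_right 0)" .
    then show ?thesis by (simp add: exp_minus field_simps)
  qed
  then have "(flat_exp m \<longlongrightarrow> 0) (at_right 0)"
    by (rule Lim_transform_eventually)
       (auto simp: flat_exp_def eventually_at_filter)
  moreover have "(flat_exp m \<longlongrightarrow> 0) (at_left 0)"
    by (rule Lim_transform_eventually[OF tendsto_const])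
       (auto simp: flat_exp_def eventually_at_filter)
  ultimately show ?thesis by (simp add: filterlim_split_at)
qed

lemma flat_exp_has_field_derivative:
  "(flat_exp m has_field_derivative (flat_exp (m + 2) t - m * flat_exp (m + 1) t)) (at t)"
proof -
  consider "t < 0" | "t = 0" | "t > 0" by linarith
  then show ?thesis
  proof cases
    case 1
    have "((\<lambda>t. 0) has_field_derivative 0) (at t)" by simp
    then have "(flat_exp m has_field_derivative 0) (at t)"
      by (rule has_field_derivative_transform_within_open[where S = "{..<0}"])
         (use 1 in \<open>auto simp: flat_exp_def\<close>)
    then show ?thesis using 1 by (simp add: flat_exp_def)
  next
    case 2
    have "((\<lambda>h. (flat_exp m (0 + h) - flat_exp m 0) / h) \<longlongrightarrow> 0) (at 0)"
      by (rule Lim_transform_eventually[OF flat_exp_tendsto_0[of "Suc m"]])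
         (auto simp: flat_exp_def eventually_at_filter divide_inverse)
    then show ?thesis using 2 by (simp add: DERIV_def flat_exp_def)
  next
    case 3
    have inv: "(inverse has_field_derivative - (inverse t ^ 2)) (at t)"
      using 3 DERIV_inverse[of t] by (simp add: numeral_2_eq_2)
    have "((\<lambda>t. inverse t ^ m) has_field_derivative - (real m * inverse t ^ (m + 1))) (at t)"
      using DERIV_power[OF inv, of m]
      by (cases m) (simp_all add: algebra_simps power2_eq_square)
    moreover have "((\<lambda>t. exp (- inverse t)) has_field_derivative exp (- inverse t) * inverse t ^ 2) (at t)"
      using DERIV_fun_exp[OF DERIV_minus[OF inv]] by simp
    ultimately have "((\<lambda>t. exp (- inverse t) * inverse t ^ m) has_field_derivative
        (flat_exp (m + 2) t - m * flat_exp (m + 1) t)) (at t)"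
      using 3 by (intro DERIV_cong[OF DERIV_mult])
        (auto simp: flat_exp_def algebra_simps power2_eq_square)
    then show ?thesis
      by (rule has_field_derivative_transform_within_open[where S = "{0<..}"])
         (use 3 in \<open>auto simp: flat_exp_def\<close>)
  qed
qed

lemma smooth_on_flat_exp: "smooth_on UNIV (flat_exp m)"
proof -
  have "Ck_on k UNIV (flat_exp m)" for k
  proof (induction k arbitrary: m)
    case 0
    have "isCont (flat_exp m) t" for t
      by (rule DERIV_isCont[OF flat_exp_has_field_derivative])
    then show ?case by (simp add: continuous_at_imp_continuous_on)
  next
    case (Suc k)
    show ?case
    proof (rule Ck_on_SucI)
      show "(flat_exp m has_derivative
          (\<lambda>v. v *\<^sub>R (flat_exp (m + 2) t + (- real m) *\<^sub>R flat_exp (m + 1) t))) (at t)" for t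
        using flat_exp_has_field_derivative[of m t]
        by (simp add: has_field_derivative_def mult.commute mult_commute_abs)
    qed (intro Ck_on_scaleR Ck_on_add Ck_on_const Suc.IH open_UNIV)+
  qed
  then show ?thesis by (simp add: smooth_on_def)
qed

lemma smooth_bump_exists:
  fixes a :: "'e::euclidean_space"
  assumes "r > 0"
  obtains \<rho> :: "'e \<Rightarrow> real" where "smooth_on UNIV \<rho>" "\<rho> a \<noteq> 0" "\<And>x. x \<notin> cball a r \<Longrightarrow> \<rho> x = 0"
proof
  \<comment> \<open>\<open>r\<^sup>2 - \<bar>x - a\<bar>\<^sup>2\<close>, spelled out as a polynomial in the coordinates to see that it is smooth\<close>
  let ?q = "\<lambda>x. r\<^sup>2 + - (\<Sum>b\<in>Basis. ((x + - a) \<bullet> b) * ((x + - a) \<bullet> b))"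
  let ?\<rho> = "\<lambda>x. flat_exp 0 (?q x)"
  have q: "?q x = r\<^sup>2 - (dist a x)\<^sup>2" for x
  proof -
    have "(dist a x)\<^sup>2 = (x - a) \<bullet> (x - a)"
      by (metis dist_commute dist_norm power2_norm_eq_inner)
    then show ?thesis unfolding euclidean_inner[of "x - a" "x - a"] by simp
  qed
  show "smooth_on UNIV ?\<rho>"
    by (rule smooth_on_compose[OF open_UNIV open_UNIV subset_UNIV _ smooth_on_flat_exp])
       (intro smooth_on_add smooth_on_minus smooth_on_sum smooth_on_mult smooth_on_inner_left
         smooth_on_ident smooth_on_const open_UNIV)
  show "?\<rho> a \<noteq> 0" using assms by (simp add: flat_exp_def)
  show "?\<rho> x = 0" if "x \<notin> cball a r" for x
  proof -
    have "r\<^sup>2 < (dist a x)\<^sup>2" using that assms by (intro power_strict_mono) auto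
    then show ?thesis unfolding q by (simp add: flat_exp_def)
  qed
qed

section \<open>Degenerate 3-forms in even dimension\<close>

text \<open>Splitting off hyperbolic planes: if \<open>\<gamma>(u, w) \<noteq> 0\<close>, then \<open>V\<close> is the direct sum of the plane
  spanned by \<open>u, w\<close> and its \<open>\<gamma>\<close>-orthogonal complement in \<open>V\<close>, on which \<open>\<gamma>\<close> is again
  non-degenerate.\<close>

lemma even_dim_nondegenerate_skew_form:
  fixes \<gamma> :: "'e::euclidean_space \<Rightarrow> 'e \<Rightarrow> real"
  assumes lin: "\<And>u. linear (\<gamma> u)" and skew: "\<And>u v. \<gamma> u v = - \<gamma> v u"
    and "subspace V" "\<And>u. u \<in> V \<Longrightarrow> (\<And>v. v \<in> V \<Longrightarrow> \<gamma> u v = 0) \<Longrightarrow> u = 0"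
  shows "even (dim V)"
  using assms(3,4)
proof (induction "dim V" arbitrary: V rule: less_induct)
  case less
  note lin_simps = linear_add[OF lin] linear_diff[OF lin] linear_cmul[OF lin]
  show ?case
  proof (cases "V \<subseteq> {0}")
    case True
    then show ?thesis using dim_eq_0 by (metis even_zero)
  next
    case False
    then obtain u where u: "u \<in> V" "u \<noteq> 0" by auto
    then obtain w where w: "w \<in> V" "\<gamma> u w \<noteq> 0" using less.prems(2) by blast
    define c where "c = \<gamma> u w"
    have c: "c \<noteq> 0" "\<gamma> w u = - c" "\<gamma> u w = c" using w skew[of w u] by (auto simp: c_def)
    have diag: "\<gamma> v v = 0" for v using skew[of v v] by simp
    define V' where "V' = {x \<in> V. \<gamma> u x = 0 \<and> \<gamma> w x = 0}"
    have V': "subspace V'"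
      using less.prems(1) by (auto simp: subspace_def V'_def lin_simps linear_0[OF lin])
    have proj: "v - (\<gamma> v w / c) *\<^sub>R u - (\<gamma> u v / c) *\<^sub>R w \<in> V'" if "v \<in> V" for v
      using that u w less.prems(1) c skew[of w v]
      by (auto simp: V'_def lin_simps diag intro!: subspace_diff subspace_mul)
    have span: "span {u, w} = {a *\<^sub>R u + b *\<^sub>R w |a b. True}"
      by (auto simp: span_insert span_singleton) (metis add_diff_cancel_left' add_diff_eq diff_add_cancel)+
    have "u \<notin> span {w}"
      using c by (auto simp: span_singleton lin_simps diag)
    moreover have "u \<noteq> w" using c diag by auto
    moreover have "w \<noteq> 0" using c linear_0[OF lin] by auto
    ultimately have "dim {u, w} = 2"
      by (subst dim_eq_card_independent) (auto simp: independent_insert)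
    then have "dim (span {u, w}) = 2" by simp
    moreover have "V' \<inter> span {u, w} \<subseteq> {0}"
      using c by (auto simp: span V'_def lin_simps diag)
    then have "dim (V' \<inter> span {u, w}) = 0" by (simp only: dim_eq_0)
    moreover have "{x + y |x y. x \<in> V' \<and> y \<in> span {u, w}} = V"
    proof (intro equalityI subsetI)
      fix v assume "v \<in> {x + y |x y. x \<in> V' \<and> y \<in> span {u, w}}"
      then show "v \<in> V"
        using less.prems(1) u w by (auto simp: V'_def span intro!: subspace_add subspace_mul)
    next
      fix v assume "v \<in> V"
      moreover have "v = (v - (\<gamma> v w / c) *\<^sub>R u - (\<gamma> u v / c) *\<^sub>R w)
          + ((\<gamma> v w / c) *\<^sub>R u + (\<gamma> u v / c) *\<^sub>R w)" by simp
      ultimately show "v \<in> {x + y |x y. x \<in> V' \<and> y \<in> span {u, w}}"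
        using proj unfolding span by blast
    qed
    ultimately have dim: "dim V = dim V' + 2"
      using dim_sums_Int[OF V' subspace_span, of "{u, w}"] by (simp only: add_0_right)
    have "y = 0" if y: "y \<in> V'" "\<And>v. v \<in> V' \<Longrightarrow> \<gamma> y v = 0" for y
    proof (rule less.prems(2))
      show "y \<in> V" using y by (simp add: V'_def)
      fix v assume "v \<in> V"
      have "\<gamma> y u = 0" "\<gamma> y w = 0" using y(1) skew[of y] by (auto simp: V'_def)
      then show "\<gamma> y v = 0" using y(2)[OF proj[OF \<open>v \<in> V\<close>]] by (simp add: lin_simps)
    qed
    then have "even (dim V')" using less.hyps[OF _ V'] dim by simp
    then show ?thesis using dim by simp
  qed
qed

text \<open>If \<open>\<beta> \<and> H = 0\<close> and \<open>\<beta>(n) \<noteq> 0\<close>, then \<open>H\<close> vanishes on the hyperplane \<open>ker \<beta>\<close>, so it is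
  determined by the skew form \<open>H(n, \<cdot>, \<cdot>)\<close> there. As \<open>ker \<beta>\<close> has odd dimension, this form has a
  non-zero radical, which is then annihilated by \<open>H\<close>.\<close>

lemma degenerate_3form_if_divisible:
  fixes H :: "'e::euclidean_space \<Rightarrow> 'e \<Rightarrow> 'e \<Rightarrow> real"
  assumes dim: "even (DIM('e))" and \<beta>: "linear \<beta>" "\<beta> n \<noteq> 0"
    and lin: "\<And>a b. linear (H a b)"
    and skew: "\<And>a b c. H a b c = - H b a c" "\<And>a b c. H a b c = - H a c b"
    and wedge: "\<And>a b c d. \<beta> a * H b c d - \<beta> b * H a c d + \<beta> c * H a b d - \<beta> d * H a b c = 0"
  obtains v where "v \<noteq> 0" "\<And>b c. H v b c = 0"
proof -
  define V where "V = {x. \<beta> x = 0}"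
  have V: "subspace V" using \<beta>(1) by (simp add: V_def linear_subspace_kernel)
  define z where "z = (\<Sum>b\<in>Basis. \<beta> b *\<^sub>R b)"
  have z: "\<beta> x = z \<bullet> x" for x
    unfolding z_def inner_sum_left
    by (subst linear_eq_sum_Basis[OF \<beta>(1)]) (simp add: inner_commute[of _ x] mult.commute)
  have "z \<noteq> 0" using \<beta>(2) z by auto
  then have "dim V = DIM('e) - 1"
    unfolding V_def z by (rule dim_hyperplane)
  then have "odd (dim V)" using dim DIM_positive[where 'a = 'e] by simp
  then obtain v where v: "v \<in> V" "v \<noteq> 0" "\<And>w. w \<in> V \<Longrightarrow> H n v w = 0"
    using even_dim_nondegenerate_skew_form[of "H n", OF lin skew(2) V] by blast
  have on_V: "H a b c = 0" if "a \<in> V" "b \<in> V" "c \<in> V" for a b c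
    using wedge[of n a b c] that \<beta>(2) by (simp add: V_def)
  have decomp: "x - (\<beta> x / \<beta> n) *\<^sub>R n \<in> V" for x
    using \<beta> by (simp add: V_def linear_diff linear_cmul)
  have "H v n c = 0" for c
  proof -
    have "H n v n = 0" using skew(1)[of n v n] skew(2)[of v n n] by simp
    then have "H n v c = 0" using v(3)[OF decomp[of c]] by (simp add: linear_diff[OF lin] linear_cmul[OF lin])
    then show ?thesis using skew(1)[of v n c] by simp
  qed
  then have n: "H v n c = 0" "H v c n = 0" for c
    using skew(2)[of v c n] by simp_all
  have "H v b c = 0" if "b \<in> V" for b c
    using on_V[OF v(1) that decomp[of c]] n by (simp add: linear_diff[OF lin] linear_cmul[OF lin])
  then have "H v c b = 0" if "b \<in> V" for b c
    using that skew(2)[of v c b] by simp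
  then have "H v b c = 0" for b c
    using n decomp[of c] linear_diff[OF lin] linear_cmul[OF lin]
    by (metis diff_zero mult_zero_right real_scaleR_def)
  then show thesis using v(2) that by blast
qed

section \<open>Smooth solutions of degenerate linear systems\<close>

text \<open>Fraction-free Gaussian elimination: near a point where some component of one of the families
  is non-zero, that family can be eliminated from all the others using products and differences
  only, so that the coefficients of the remaining relation stay smooth.\<close>

lemma smooth_linear_dependence:
  fixes w :: "'b \<Rightarrow> 'k \<Rightarrow> 'e::euclidean_space \<Rightarrow> real"
  assumes "finite B" "open S" "S \<noteq> {}"
    and "\<And>b k. b \<in> B \<Longrightarrow> smooth_on S (w b k)"
    and "\<And>x. x \<in> S \<Longrightarrow> \<exists>c. (\<exists>b\<in>B. c b \<noteq> 0) \<and> (\<forall>k. (\<Sum>b\<in>B. c b * w b k x) = 0)"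
  obtains T c where "open T" "T \<noteq> {}" "T \<subseteq> S" "\<And>b. b \<in> B \<Longrightarrow> smooth_on T (c b)"
    "\<And>x. x \<in> T \<Longrightarrow> \<exists>b\<in>B. c b x \<noteq> (0::real)" "\<And>x k. x \<in> T \<Longrightarrow> (\<Sum>b\<in>B. c b x * w b k x) = 0"
  using assms
proof (induction B arbitrary: w S thesis rule: finite_induct)
  case empty
  then show ?case by blast
next
  case (insert m B)
  show ?case
  proof (cases "\<exists>x\<in>S. \<exists>k. w m k x \<noteq> 0")
    case False
    show ?thesis
    proof (rule insert.prems(1))
      show "open S" "S \<noteq> {}" "S \<subseteq> S" using insert.prems by auto
      show "smooth_on S (\<lambda>x. if b = m then 1 else 0)" for b
        using insert.prems by (auto intro: smooth_on_const)
      show "\<exists>b\<in>insert m B. (if b = m then 1 else 0) \<noteq> (0::real)" by auto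
      fix x k assume "x \<in> S"
      have "(\<Sum>b\<in>B. (if b = m then 1 else 0) * w b k x) = (\<Sum>b\<in>B. 0)"
        using insert.hyps by (intro sum.cong) auto
      then show "(\<Sum>b\<in>insert m B. (if b = m then 1 else 0) * w b k x) = 0"
        using False \<open>x \<in> S\<close> insert.hyps by simp
    qed
  next
    case True
    then obtain k0 x0 where x0: "x0 \<in> S" "w m k0 x0 \<noteq> 0" by blast
    have cont: "continuous_on S (w m k0)"
      using insert.prems by (intro smooth_on_imp_continuous_on) simp
    define S' where "S' = S \<inter> w m k0 -` (- {0})"
    have S': "open S'" "S' \<noteq> {}" "S' \<subseteq> S"
      unfolding S'_def using x0 insert.prems(2)
      by (auto intro!: continuous_open_preimage[OF cont])
    define w' where "w' b k x = w m k0 x * w b k x - w b k0 x * w m k x" for b k x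
    obtain T c where T: "open T" "T \<noteq> {}" "T \<subseteq> S'" "\<And>b. b \<in> B \<Longrightarrow> smooth_on T (c b)"
      "\<And>x. x \<in> T \<Longrightarrow> \<exists>b\<in>B. c b x \<noteq> (0::real)" "\<And>x k. x \<in> T \<Longrightarrow> (\<Sum>b\<in>B. c b x * w' b k x) = 0"
    proof (rule insert.IH[OF _ S'(1,2), of w'])
      show "smooth_on S' (w' b k)" if "b \<in> B" for b k
        unfolding w'_def
        by (intro smooth_on_diff smooth_on_mult S' smooth_on_subset[OF insert.prems(4) S'(3)])
           (use that in auto)
      fix x assume x: "x \<in> S'"
      then obtain c where c: "\<exists>b\<in>insert m B. c b \<noteq> 0" "\<And>k. (\<Sum>b\<in>insert m B. c b * w b k x) = 0"
        using insert.prems(5)[of x] S' by blast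
      have rel: "(\<Sum>b\<in>B. c b * w b k x) = - (c m * w m k x)" for k
        using c(2)[of k] insert.hyps by simp
      have "\<exists>b\<in>B. c b \<noteq> 0"
      proof (rule ccontr)
        assume none: "\<not> (\<exists>b\<in>B. c b \<noteq> 0)"
        then have "c m * w m k0 x = 0" using rel[of k0] by simp
        then show False using none c(1) x by (auto simp: S'_def)
      qed
      moreover have "(\<Sum>b\<in>B. c b * w' b k x) = 0" for k
      proof -
        have "(\<Sum>b\<in>B. c b * w' b k x) =
            w m k0 x * (\<Sum>b\<in>B. c b * w b k x) - (\<Sum>b\<in>B. c b * w b k0 x) * w m k x"
          by (simp add: w'_def right_diff_distrib sum_subtractf sum_distrib_left
                sum_distrib_right mult_ac)
        then show ?thesis by (simp add: rel)
      qed
      ultimately show "\<exists>c. (\<exists>b\<in>B. c b \<noteq> 0) \<and> (\<forall>k. (\<Sum>b\<in>B. c b * w' b k x) = 0)" by blast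
    qed blast
    define c' where "c' b x = (if b = m then - (\<Sum>b\<in>B. c b x * w b k0 x) else c b x * w m k0 x)" for b x
    have T': "T \<subseteq> S" using T S' by blast
    show ?thesis
    proof (rule insert.prems(1)[OF T(1,2) T'])
      have w: "smooth_on T (w b k)" if "b \<in> insert m B" for b k
        using insert.prems(4)[OF that] T' by (rule smooth_on_subset)
      show "smooth_on T (c' b)" if "b \<in> insert m B" for b
        unfolding c'_def using that
        by (cases "b = m") (auto intro!: smooth_on_minus smooth_on_sum smooth_on_mult T w)
      show "\<exists>b\<in>insert m B. c' b x \<noteq> 0" if x: "x \<in> T" for x
      proof -
        have "w m k0 x \<noteq> 0" using x T(3) by (auto simp: S'_def)
        moreover obtain b where "b \<in> B" "c b x \<noteq> 0" using T(5)[OF x] by blast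
        ultimately show ?thesis using insert.hyps by (intro bexI[of _ b]) (auto simp: c'_def)
      qed
      fix x k assume x: "x \<in> T"
      have "(\<Sum>b\<in>B. c' b x * w b k x) = (\<Sum>b\<in>B. c b x * w m k0 x * w b k x)"
        using insert.hyps by (intro sum.cong) (auto simp: c'_def)
      moreover have "(\<Sum>b\<in>B. c b x * w' b k x) =
          (\<Sum>b\<in>B. c b x * w m k0 x * w b k x) - (\<Sum>b\<in>B. c b x * w b k0 x) * w m k x"
        by (simp add: w'_def right_diff_distrib sum_subtractf sum_distrib_left sum_distrib_right mult_ac)
      ultimately show "(\<Sum>b\<in>insert m B. c' b x * w b k x) = 0"
        using T(6)[OF x, of k] insert.hyps by (simp add: c'_def)
    qed
  qed
qed

section \<open>The exterior derivative of a 2-form in coordinates\<close>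

definition two_form_on :: "'e::euclidean_space set \<Rightarrow> ('e \<Rightarrow> 'e \<Rightarrow> 'e \<Rightarrow> real) \<Rightarrow> bool" where
  "two_form_on S \<omega> \<longleftrightarrow> (\<forall>x\<in>S. \<forall>a. linear (\<omega> x a)) \<and> (\<forall>x\<in>S. \<forall>a b. \<omega> x a b = - \<omega> x b a) \<and>
     (\<forall>a b. smooth_on S (\<lambda>x. \<omega> x a b))"

text \<open>The case of degree 2 of the coordinate formula behind \<open>ext_deriv\<close>, for a form given by its
  components on an open set of the model space.\<close>

definition ext_deriv2 :: "('e::euclidean_space \<Rightarrow> 'e \<Rightarrow> 'e \<Rightarrow> real) \<Rightarrow> 'e \<Rightarrow> 'e \<Rightarrow> 'e \<Rightarrow> 'e \<Rightarrow> real" where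
  "ext_deriv2 \<omega> x u v w =
     frechet_derivative (\<lambda>y. \<omega> y v w) (at x) u - frechet_derivative (\<lambda>y. \<omega> y u w) (at x) v
     + frechet_derivative (\<lambda>y. \<omega> y u v) (at x) w"

lemma bilinear_eq_sum_Basis:
  fixes F :: "'e::euclidean_space \<Rightarrow> 'e \<Rightarrow> real"
  assumes "\<And>a. linear (F a)" "\<And>b. linear (\<lambda>a. F a b)"
  shows "F a b = (\<Sum>i\<in>Basis. \<Sum>j\<in>Basis. (a \<bullet> i) * (b \<bullet> j) * F i j)"
proof -
  have "F a b = (\<Sum>i\<in>Basis. (a \<bullet> i) *\<^sub>R F i b)"
    by (rule linear_eq_sum_Basis[OF assms(2)])
  also have "\<dots> = (\<Sum>i\<in>Basis. (a \<bullet> i) *\<^sub>R (\<Sum>j\<in>Basis. (b \<bullet> j) *\<^sub>R F i j))"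
    by (intro sum.cong refl arg_cong2[where f = scaleR] linear_eq_sum_Basis[OF assms(1)])
  finally show ?thesis by (simp add: sum_distrib_left mult.assoc)
qed

context
  fixes S :: "'e::euclidean_space set" and \<omega> :: "'e \<Rightarrow> 'e \<Rightarrow> 'e \<Rightarrow> real"
  assumes S: "open S" and \<omega>: "two_form_on S \<omega>"
begin

lemma two_form_linear_right: "x \<in> S \<Longrightarrow> linear (\<omega> x a)"
  and two_form_skew: "x \<in> S \<Longrightarrow> \<omega> x a b = - \<omega> x b a"
  and two_form_smooth: "smooth_on S (\<lambda>x. \<omega> x a b)"
  using \<omega> unfolding two_form_on_def by blast+

lemma two_form_linear_left: "x \<in> S \<Longrightarrow> linear (\<lambda>a. \<omega> x a b)"
  using linear_compose_neg[OF two_form_linear_right, of x b] two_form_skew[of x _ b] by simp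

lemma two_form_has_derivative:
  "x \<in> S \<Longrightarrow> ((\<lambda>y. \<omega> y a b) has_derivative frechet_derivative (\<lambda>y. \<omega> y a b) (at x)) (at x)"
  by (rule smooth_on_imp_has_derivative[OF two_form_smooth S])

lemma two_form_derivative_linear_right:
  assumes "x \<in> S"
  shows "linear (\<lambda>b. frechet_derivative (\<lambda>y. \<omega> y a b) (at x) e)"
proof (rule linearI)
  fix b b' :: 'e and r :: real
  have "((\<lambda>y. \<omega> y a (b + b')) has_derivative
      (\<lambda>e. frechet_derivative (\<lambda>y. \<omega> y a b) (at x) e + frechet_derivative (\<lambda>y. \<omega> y a b') (at x) e)) (at x)"
    by (rule has_derivative_transform_within_open[OF has_derivative_add[OF
            two_form_has_derivative[OF assms] two_form_has_derivative[OF assms]] S assms])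
       (simp add: linear_add[OF two_form_linear_right])
  then show "frechet_derivative (\<lambda>y. \<omega> y a (b + b')) (at x) e =
      frechet_derivative (\<lambda>y. \<omega> y a b) (at x) e + frechet_derivative (\<lambda>y. \<omega> y a b') (at x) e"
    by (rule frechet_derivative_apply)
  have "((\<lambda>y. \<omega> y a (r *\<^sub>R b)) has_derivative
      (\<lambda>e. r *\<^sub>R frechet_derivative (\<lambda>y. \<omega> y a b) (at x) e)) (at x)"
    by (rule has_derivative_transform_within_open[OF has_derivative_scaleR_right[OF
            two_form_has_derivative[OF assms]] S assms])
       (simp add: linear_cmul[OF two_form_linear_right])
  then show "frechet_derivative (\<lambda>y. \<omega> y a (r *\<^sub>R b)) (at x) e =
      r *\<^sub>R frechet_derivative (\<lambda>y. \<omega> y a b) (at x) e"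
    by (rule frechet_derivative_apply)
qed

lemma two_form_derivative_skew:
  assumes "x \<in> S"
  shows "frechet_derivative (\<lambda>y. \<omega> y a b) (at x) e = - frechet_derivative (\<lambda>y. \<omega> y b a) (at x) e"
proof -
  have "((\<lambda>y. \<omega> y a b) has_derivative (\<lambda>e. - frechet_derivative (\<lambda>y. \<omega> y b a) (at x) e)) (at x)"
    by (rule has_derivative_transform_within_open[OF has_derivative_minus[OF
            two_form_has_derivative[OF assms]] S assms])
       (simp add: two_form_skew[of _ a b])
  then show ?thesis by (rule frechet_derivative_apply)
qed

lemma two_form_derivative_linear_left:
  assumes "x \<in> S"
  shows "linear (\<lambda>a. frechet_derivative (\<lambda>y. \<omega> y a b) (at x) e)"
  using linear_compose_neg[OF two_form_derivative_linear_right[OF assms, of b e]]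
    two_form_derivative_skew[OF assms, of _ b e] by simp

lemma ext_deriv2_skew:
  assumes "x \<in> S"
  shows "ext_deriv2 \<omega> x u v w = - ext_deriv2 \<omega> x v u w" "ext_deriv2 \<omega> x u v w = - ext_deriv2 \<omega> x u w v"
  using two_form_derivative_skew[OF assms, of u v w] two_form_derivative_skew[OF assms, of v w u]
  by (simp_all add: ext_deriv2_def)

lemma ext_deriv2_linear:
  assumes "x \<in> S"
  shows "linear (ext_deriv2 \<omega> x u v)"
  unfolding ext_deriv2_def
  by (intro linear_compose_add linear_compose_sub two_form_derivative_linear_right assms
      linear_frechet_derivative[OF differentiableI[OF two_form_has_derivative[OF assms]]])

lemma smooth_on_ext_deriv2:
  assumes "smooth_on S u" "smooth_on S v" "smooth_on S w"
  shows "smooth_on S (\<lambda>x. ext_deriv2 \<omega> x (u x) (v x) (w x))"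
proof -
  have const: "smooth_on S (\<lambda>x. ext_deriv2 \<omega> x a b c)" for a b c
    unfolding ext_deriv2_def
    by (intro smooth_on_add smooth_on_diff smooth_on_frechet_derivative S two_form_smooth)
  have w: "smooth_on S (\<lambda>x. ext_deriv2 \<omega> x a b (w x))" for a b
    by (rule smooth_on_linear_apply[OF S ext_deriv2_linear const assms(3)])
  have wv: "smooth_on S (\<lambda>x. - ext_deriv2 \<omega> x a (w x) (v x))" for a
  proof (rule smooth_on_minus[OF S], rule smooth_on_linear_apply[OF S ext_deriv2_linear _ assms(2)])
    show "smooth_on S (\<lambda>x. ext_deriv2 \<omega> x a (w x) b)" for b
      by (rule smooth_on_cong[OF S smooth_on_minus[OF S w[of a b]]])
         (simp add: ext_deriv2_skew(2)[of _ a _ b])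
  qed
  have vw: "smooth_on S (\<lambda>x. ext_deriv2 \<omega> x a (v x) (w x))" for a
    by (rule smooth_on_cong[OF S wv[of a]]) (rule ext_deriv2_skew(2)[symmetric])
  have cyc: "ext_deriv2 \<omega> x a b c = ext_deriv2 \<omega> x b c a" if "x \<in> S" for x a b c
    using ext_deriv2_skew(1)[OF that, of a b c] ext_deriv2_skew(2)[OF that, of b a c] by simp
  have "smooth_on S (\<lambda>x. ext_deriv2 \<omega> x (v x) (w x) (u x))"
  proof (rule smooth_on_linear_apply[OF S ext_deriv2_linear _ assms(1)])
    show "smooth_on S (\<lambda>x. ext_deriv2 \<omega> x (v x) (w x) a)" for a
      by (rule smooth_on_cong[OF S vw[of a]]) (rule cyc)
  qed
  then show ?thesis
    by (rule smooth_on_cong[OF S]) (rule cyc[symmetric])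
qed

text \<open>After expansion of \<open>A\<close> and \<open>B\<close> in a basis, this is the product rule for real functions.\<close>

lemma two_form_product_rule:
  assumes \<phi>: "(\<phi> has_derivative \<phi>') (at x)" "\<phi> x \<in> S"
    and A: "(A has_derivative A') (at x)" and B: "(B has_derivative B') (at x)"
  shows "((\<lambda>z. \<omega> (\<phi> z) (A z) (B z)) has_derivative
     (\<lambda>e. frechet_derivative (\<lambda>y. \<omega> y (A x) (B x)) (at (\<phi> x)) (\<phi>' e)
          + \<omega> (\<phi> x) (A' e) (B x) + \<omega> (\<phi> x) (A x) (B' e))) (at x)"
proof -
  let ?D = "\<lambda>i j. frechet_derivative (\<lambda>y. \<omega> y i j) (at (\<phi> x))"
  note expand = bilinear_eq_sum_Basis[OF two_form_linear_right two_form_linear_left]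
  have "((\<lambda>z. \<Sum>i\<in>Basis. \<Sum>j\<in>Basis. (A z \<bullet> i) * (B z \<bullet> j) * \<omega> (\<phi> z) i j) has_derivative
      (\<lambda>e. \<Sum>i\<in>Basis. \<Sum>j\<in>Basis. (A x \<bullet> i) * (B x \<bullet> j) * ?D i j (\<phi>' e)
         + ((A x \<bullet> i) * (B' e \<bullet> j) + (A' e \<bullet> i) * (B x \<bullet> j)) * \<omega> (\<phi> x) i j)) (at x)"
    by (intro has_derivative_sum has_derivative_mult has_derivative_inner_left A B
        has_derivative_compose[OF \<phi>(1) two_form_has_derivative[OF \<phi>(2)]])
  moreover have "(\<Sum>i\<in>Basis. \<Sum>j\<in>Basis. (A x \<bullet> i) * (B x \<bullet> j) * ?D i j (\<phi>' e)
         + ((A x \<bullet> i) * (B' e \<bullet> j) + (A' e \<bullet> i) * (B x \<bullet> j)) * \<omega> (\<phi> x) i j) =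
      ?D (A x) (B x) (\<phi>' e) + \<omega> (\<phi> x) (A' e) (B x) + \<omega> (\<phi> x) (A x) (B' e)" for e
  proof -
    have "?D (A x) (B x) (\<phi>' e) =
        (\<Sum>i\<in>Basis. \<Sum>j\<in>Basis. (A x \<bullet> i) * (B x \<bullet> j) * ?D i j (\<phi>' e))"
      by (rule bilinear_eq_sum_Basis[OF two_form_derivative_linear_right[OF \<phi>(2)]
            two_form_derivative_linear_left[OF \<phi>(2)]])
    moreover note expand[OF \<phi>(2) \<phi>(2), of "A' e" "B x"] expand[OF \<phi>(2) \<phi>(2), of "A x" "B' e"]
    ultimately show ?thesis
      by (simp only: sum.distrib distrib_right)
  qed
  ultimately have "((\<lambda>z. \<Sum>i\<in>Basis. \<Sum>j\<in>Basis. (A z \<bullet> i) * (B z \<bullet> j) * \<omega> (\<phi> z) i j) has_derivative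
      (\<lambda>e. ?D (A x) (B x) (\<phi>' e) + \<omega> (\<phi> x) (A' e) (B x) + \<omega> (\<phi> x) (A x) (B' e))) (at x)"
    by (simp only:)
  then show ?thesis
  proof (rule has_derivative_transform_eventually)
    have "\<forall>\<^sub>F z in at x. \<phi> z \<in> S"
      using has_derivative_continuous[OF \<phi>(1)] S \<phi>(2)
      by (simp add: continuous_within topological_tendstoD)
    then show "\<forall>\<^sub>F z in at x. (\<Sum>i\<in>Basis. \<Sum>j\<in>Basis. (A z \<bullet> i) * (B z \<bullet> j) * \<omega> (\<phi> z) i j) =
        \<omega> (\<phi> z) (A z) (B z)"
      by (rule eventually_mono) (rule expand[symmetric])
    show "(\<Sum>i\<in>Basis. \<Sum>j\<in>Basis. (A x \<bullet> i) * (B x \<bullet> j) * \<omega> (\<phi> x) i j) = \<omega> (\<phi> x) (A x) (B x)"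
      by (rule expand[OF \<phi>(2) \<phi>(2), symmetric])
  qed simp
qed

text \<open>The terms with second derivatives of \<open>\<phi>\<close> cancel in the alternating sum, because
  second derivatives are symmetric.\<close>

lemma ext_deriv2_pullback:
  assumes R: "open R" "x \<in> R" "smooth_on R \<phi>" "\<phi> ` R \<subseteq> S"
    and pull: "\<And>y a b. y \<in> R \<Longrightarrow> \<eta> y a b =
      \<omega> (\<phi> y) (frechet_derivative \<phi> (at y) a) (frechet_derivative \<phi> (at y) b)"
  shows "ext_deriv2 \<eta> x u v w = ext_deriv2 \<omega> (\<phi> x) (frechet_derivative \<phi> (at x) u)
    (frechet_derivative \<phi> (at x) v) (frechet_derivative \<phi> (at x) w)"
proof -
  let ?D = "\<lambda>a y. frechet_derivative \<phi> (at y) a"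
  let ?DD = "\<lambda>a. frechet_derivative (?D a) (at x)"
  have \<phi>x: "\<phi> x \<in> S" using R by auto
  have "((\<lambda>y. \<eta> y a b) has_derivative
     (\<lambda>e. frechet_derivative (\<lambda>y. \<omega> y (?D a x) (?D b x)) (at (\<phi> x)) (?D e x)
          + \<omega> (\<phi> x) (?DD a e) (?D b x) + \<omega> (\<phi> x) (?D a x) (?DD b e))) (at x)" for a b
    by (rule has_derivative_transform_within_open[OF two_form_product_rule[where
            x = x and \<phi> = \<phi> and A = "?D a" and B = "?D b", OF _ \<phi>x] R(1,2)])
       (simp_all add: pull smooth_on_imp_has_derivative[OF _ R(1,2)] smooth_on_frechet_derivative R(3))
  then have "frechet_derivative (\<lambda>y. \<eta> y a b) (at x) e =
     frechet_derivative (\<lambda>y. \<omega> y (?D a x) (?D b x)) (at (\<phi> x)) (?D e x)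
          + \<omega> (\<phi> x) (?DD a e) (?D b x) + \<omega> (\<phi> x) (?D a x) (?DD b e)" for a b e
    by (rule frechet_derivative_apply)
  moreover have "?DD a b = ?DD b a" for a b
    by (rule second_derivative_symmetric[OF R(3,1,2)])
  ultimately show ?thesis
    using two_form_skew[OF \<phi>x, of "?D u x" "?DD w v"] two_form_skew[OF \<phi>x, of "?D u x" "?DD v w"]
      two_form_skew[OF \<phi>x, of "?D v x" "?DD u w"] two_form_skew[OF \<phi>x, of "?D w x" "?DD u v"]
    by (simp add: ext_deriv2_def)
qed

end

section \<open>Charts and tangent vectors\<close>

lemma chart_inv_in: "x \<in> snd c ` fst c \<Longrightarrow> chart_inv c x \<in> fst c"
  and chart_inv_right: "x \<in> snd c ` fst c \<Longrightarrow> snd c (chart_inv c x) = x"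
  by (simp_all add: chart_inv_def inv_into_into f_inv_into_f)

definition extend_by_zero :: "('a, 'e::euclidean_space) chart \<Rightarrow> ('e \<Rightarrow> 'e) \<Rightarrow> ('a, 'e) vector_field" where
  "extend_by_zero c Z = (\<lambda>c' p. if p \<in> fst c then tangent_transition c c' p (Z (snd c p)) else 0)"

definition differential :: "('a \<Rightarrow> real) \<Rightarrow> ('a, 'e::euclidean_space) cov_tensor" where
  "differential f = (\<lambda>c p vs. frechet_derivative (f \<circ> chart_inv c) (at (snd c p)) (vs ! 0))"

context
  fixes M :: "'a topology" and A :: "('a, 'e::euclidean_space) chart set"
  assumes mfd: "smooth_manifold M A"
begin

lemma openin_chart_domain: "c \<in> A \<Longrightarrow> openin M (fst c)"
  and open_chart_range: "c \<in> A \<Longrightarrow> open (snd c ` fst c)"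
  and homeomorphic_map_chart:
    "c \<in> A \<Longrightarrow> homeomorphic_map (subtopology M (fst c)) (top_of_set (snd c ` fst c)) (snd c)"
  using mfd by (simp_all add: smooth_manifold_def smooth_structure_def is_chart_def)

lemma chart_domain_subset: "c \<in> A \<Longrightarrow> fst c \<subseteq> topspace M"
  by (rule openin_subset[OF openin_chart_domain])

lemma chart_inv_left: "c \<in> A \<Longrightarrow> p \<in> fst c \<Longrightarrow> chart_inv c (snd c p) = p"
proof -
  assume c: "c \<in> A" and p: "p \<in> fst c"
  have "inj_on (snd c) (topspace (subtopology M (fst c)))"
    by (rule homeomorphic_imp_injective_map[OF homeomorphic_map_chart[OF c]])
  then have "inj_on (snd c) (fst c)"
    using chart_domain_subset[OF c] by (simp add: Int_absorb1)
  then show ?thesis using p by (simp add: chart_inv_def)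
qed

lemma chart_open_image:
  assumes c: "c \<in> A" and W: "openin M W"
  shows "open (snd c ` (fst c \<inter> W))"
proof -
  have "open_map (subtopology M (fst c)) (top_of_set (snd c ` fst c)) (snd c)"
    by (rule homeomorphic_imp_open_map[OF homeomorphic_map_chart[OF c]])
  moreover have "openin (subtopology M (fst c)) (fst c \<inter> W)"
    using W by (auto simp: openin_subtopology)
  ultimately have "openin (top_of_set (snd c ` fst c)) (snd c ` (fst c \<inter> W))"
    by (simp add: open_map_def)
  then show ?thesis
    by (simp add: openin_open_eq[OF open_chart_range[OF c]])
qed

lemma open_chart_overlap: "c \<in> A \<Longrightarrow> c' \<in> A \<Longrightarrow> open (snd c ` (fst c \<inter> fst c'))"
  by (rule chart_open_image[OF _ openin_chart_domain])

lemma closedin_chart_compact: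
  assumes c: "c \<in> A" and K: "compact K" "K \<subseteq> snd c ` fst c"
  shows "closedin M (chart_inv c ` K)"
proof -
  obtain h where h: "homeomorphic_maps (subtopology M (fst c)) (top_of_set (snd c ` fst c)) (snd c) h"
    using homeomorphic_map_chart[OF c] unfolding homeomorphic_map_maps by blast
  have "chart_inv c ` K = h ` K"
  proof (rule image_cong[OF refl])
    fix x assume "x \<in> K"
    then have x: "x \<in> snd c ` fst c" using K by auto
    have "h x \<in> topspace (subtopology M (fst c))" "snd c (h x) = x"
      using h x by (auto simp: homeomorphic_maps_def continuous_map_def)
    then show "chart_inv c x = h x"
      using chart_inv_left[OF c, of "h x"] by auto
  qed
  moreover have "compactin (subtopology M (fst c)) (h ` K)"
    using h K by (intro image_compactin[where X = "top_of_set (snd c ` fst c)"])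
      (auto simp: homeomorphic_maps_def compactin_subtopology)
  ultimately have "compactin M (chart_inv c ` K)"
    by (simp add: compactin_subtopology)
  then show ?thesis
    using mfd compactin_imp_closedin by (auto simp: smooth_manifold_def)
qed

lemma transition_chart: "c \<in> A \<Longrightarrow> p \<in> fst c \<Longrightarrow> transition c c' (snd c p) = snd c' p"
  by (simp add: transition_def chart_inv_left)

lemma smooth_on_transition:
  "c \<in> A \<Longrightarrow> c' \<in> A \<Longrightarrow> smooth_on (snd c ` (fst c \<inter> fst c')) (transition c c')"
  using mfd by (simp add: smooth_manifold_def smooth_structure_def compatible_def)

lemma transition_has_derivative:
  assumes "c \<in> A" "c' \<in> A" "p \<in> fst c" "p \<in> fst c'"
  shows "(transition c c' has_derivative tangent_transition c c' p) (at (snd c p))"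
  unfolding tangent_transition_def using assms
  by (intro smooth_on_imp_has_derivative[OF smooth_on_transition open_chart_overlap]) auto

lemma linear_tangent_transition:
  "c \<in> A \<Longrightarrow> c' \<in> A \<Longrightarrow> p \<in> fst c \<Longrightarrow> p \<in> fst c' \<Longrightarrow> linear (tangent_transition c c' p)"
  by (rule has_derivative_linear[OF transition_has_derivative])

lemma tangent_transition_cocycle:
  assumes c: "c \<in> A" "c' \<in> A" "c'' \<in> A" and p: "p \<in> fst c" "p \<in> fst c'" "p \<in> fst c''"
  shows "tangent_transition c' c'' p (tangent_transition c c' p v) = tangent_transition c c'' p v"
proof -
  have "(transition c c'' has_derivative
      (\<lambda>v. tangent_transition c' c'' p (tangent_transition c c' p v))) (at (snd c p))"
  proof (rule has_derivative_transform_within_open)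
    show "((\<lambda>x. transition c' c'' (transition c c' x)) has_derivative
        (\<lambda>v. tangent_transition c' c'' p (tangent_transition c c' p v))) (at (snd c p))"
      by (rule has_derivative_compose[OF transition_has_derivative])
         (use assms transition_has_derivative in \<open>simp_all add: transition_chart\<close>)
    show "open (snd c ` (fst c \<inter> fst c'))" "snd c p \<in> snd c ` (fst c \<inter> fst c')"
      using open_chart_overlap c p by auto
    show "transition c' c'' (transition c c' x) = transition c c'' x"
      if "x \<in> snd c ` (fst c \<inter> fst c')" for x
      using that c by (auto simp: transition_chart)
  qed
  then show ?thesis
    unfolding tangent_transition_def[of c c''] by (rule frechet_derivative_apply[symmetric])
qed

lemma tangent_transition_self:
  assumes "c \<in> A" "p \<in> fst c"
  shows "tangent_transition c c p v = v"
proof -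
  have "(transition c c has_derivative (\<lambda>v. v)) (at (snd c p))"
    by (rule has_derivative_transform_within_open[OF has_derivative_ident open_chart_range[OF assms(1)]])
       (use assms in \<open>auto simp: transition_chart\<close>)
  then show ?thesis
    unfolding tangent_transition_def by (rule frechet_derivative_apply)
qed

text \<open>In another chart the extended field is smooth on the overlap by the chain rule. It vanishes on
  the complement of the image of \<open>K\<close>, and this complement is open because \<open>M\<close> is Hausdorff.\<close>

lemma smooth_vector_field_extend_by_zero:
  assumes c: "c \<in> A" and Z: "smooth_on (snd c ` fst c) Z"
    and K: "compact K" "K \<subseteq> snd c ` fst c" "\<And>x. x \<in> snd c ` fst c \<Longrightarrow> x \<notin> K \<Longrightarrow> Z x = 0"
  shows "smooth_vector_field A (extend_by_zero c Z)"
  unfolding smooth_vector_field_def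
proof (intro conjI ballI)
  fix c' c'' p assume "c' \<in> A" "c'' \<in> A" "p \<in> fst c' \<inter> fst c''"
  then show "extend_by_zero c Z c'' p = tangent_transition c' c'' p (extend_by_zero c Z c' p)"
    using c tangent_transition_cocycle[of c c' c'' p] linear_0[OF linear_tangent_transition, of c' c'' p]
    by (auto simp: extend_by_zero_def)
next
  fix c' assume c': "c' \<in> A"
  let ?X = "\<lambda>x. extend_by_zero c Z c' (chart_inv c' x)"
  let ?K = "chart_inv c ` K"
  have openK: "openin M (topspace M - ?K)"
    using closedin_chart_compact[OF c K(1,2)] by (simp add: closedin_def)
  show "smooth_on (snd c' ` fst c') ?X"
  proof (rule smooth_on_local[OF open_chart_range[OF c']])
    fix x assume "x \<in> snd c' ` fst c'"
    then obtain p where p: "p \<in> fst c'" "x = snd c' p" by auto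
    show "\<exists>T. open T \<and> x \<in> T \<and> smooth_on T ?X"
    proof (cases "p \<in> fst c")
      case True
      let ?T = "snd c' ` (fst c' \<inter> fst c)" and ?S = "snd c ` (fst c \<inter> fst c')"
      have T: "open ?T" and S: "open ?S" using open_chart_overlap c c' by auto
      have \<tau>: "transition c' c ` ?T \<subseteq> ?S" using c' by (auto simp: transition_chart)
      have \<tau>s: "smooth_on ?T (transition c' c)" by (rule smooth_on_transition[OF c' c])
      have "smooth_on ?T (\<lambda>x. frechet_derivative (transition c c') (at (transition c' c x))
          (Z (transition c' c x)))"
      proof (rule smooth_on_linear_apply[OF T, where v = "\<lambda>x. Z (transition c' c x)"])
        show "linear (frechet_derivative (transition c c') (at (transition c' c x)))" if "x \<in> ?T" for x
          using that c c' linear_tangent_transition[of c c']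
          by (auto simp: transition_chart tangent_transition_def)
        show "smooth_on ?T (\<lambda>x. frechet_derivative (transition c c') (at (transition c' c x)) b)" for b
          by (rule smooth_on_compose[OF T S \<tau> \<tau>s smooth_on_frechet_derivative[OF smooth_on_transition[OF c c']]])
        show "smooth_on ?T (\<lambda>x. Z (transition c' c x))"
          by (rule smooth_on_compose[OF T S \<tau> \<tau>s smooth_on_subset[OF Z]]) auto
      qed
      then have "smooth_on ?T ?X"
        by (rule smooth_on_cong[OF T])
           (use c' in \<open>auto simp: extend_by_zero_def chart_inv_left transition_chart tangent_transition_def\<close>)
      then show ?thesis using T True p by blast
    next
      case False
      let ?T = "snd c' ` (fst c' \<inter> (topspace M - ?K))"
      have "open ?T" by (rule chart_open_image[OF c' openK])
      moreover have "?K \<subseteq> fst c"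
        by (intro image_subsetI chart_inv_in) (rule subsetD[OF K(2)])
      then have "p \<notin> ?K" using False by (rule contra_subsetD)
      then have "x \<in> ?T" using p chart_domain_subset[OF c'] by auto
      moreover have "smooth_on ?T ?X"
      proof (rule smooth_on_cong[OF \<open>open ?T\<close> smooth_on_const[OF \<open>open ?T\<close>, of 0]])
        fix y assume "y \<in> ?T"
        then obtain q where q: "q \<in> fst c'" "q \<notin> ?K" "y = snd c' q" by auto
        have "Z (snd c q) = 0" if "q \<in> fst c"
          using that q chart_inv_left[OF c that] by (intro K(3)) force+
        then show "0 = ?X y"
          using q c c' linear_0[OF linear_tangent_transition, of c c' q]
          by (auto simp: extend_by_zero_def chart_inv_left)
      qed
      ultimately show ?thesis by blast
    qed
  qed
qed

section \<open>The differential of a function and the Leibniz rule\<close>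

lemma smooth_function_has_derivative:
  assumes "smooth_function_on A W f" "openin M W" "c \<in> A" "p \<in> fst c" "p \<in> W"
  shows "((f \<circ> chart_inv c) has_derivative (\<lambda>v. differential f c p [v])) (at (snd c p))"
proof -
  have "smooth_on (snd c ` (fst c \<inter> W)) (f \<circ> chart_inv c)"
    using assms by (simp add: smooth_function_on_def)
  from smooth_on_imp_has_derivative[OF this chart_open_image[OF assms(3,2)], of "snd c p"]
  show ?thesis using assms by (simp add: differential_def)
qed

lemma differential_tangent_transition:
  assumes f: "smooth_function_on A W f" "openin M W" and c: "c \<in> A" "c' \<in> A"
    and p: "p \<in> fst c" "p \<in> fst c'" "p \<in> W"
  shows "differential f c' p [tangent_transition c c' p v] = differential f c p [v]"
proof -
  have "((f \<circ> chart_inv c) has_derivative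
      (\<lambda>v. differential f c' p [tangent_transition c c' p v])) (at (snd c p))"
  proof (rule has_derivative_transform_within_open)
    show "((\<lambda>x. (f \<circ> chart_inv c') (transition c c' x)) has_derivative
        (\<lambda>v. differential f c' p [tangent_transition c c' p v])) (at (snd c p))"
      by (rule has_derivative_compose[OF transition_has_derivative[OF c p(1,2)]])
         (simp only: transition_chart[OF c(1) p(1)] smooth_function_has_derivative[OF f c(2) p(2,3)])
    show "open (snd c ` (fst c \<inter> fst c'))" "snd c p \<in> snd c ` (fst c \<inter> fst c')"
      using open_chart_overlap c p by auto
    show "(f \<circ> chart_inv c') (transition c c' x) = (f \<circ> chart_inv c) x"
      if "x \<in> snd c ` (fst c \<inter> fst c')" for x
      using that c by (auto simp: transition_chart chart_inv_left)
  qed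
  then have "frechet_derivative (f \<circ> chart_inv c) (at (snd c p)) v =
      differential f c' p [tangent_transition c c' p v]"
    by (rule frechet_derivative_apply)
  then show ?thesis by (simp add: differential_def)
qed

lemma ext_deriv_scale_form:
  assumes c: "c \<in> A" "p \<in> fst c"
    and \<phi>: "((\<phi> \<circ> chart_inv c) has_derivative (\<lambda>v. differential \<phi> c p [v])) (at (snd c p))"
    and \<omega>: "\<And>i. i < length vs \<Longrightarrow>
      (\<lambda>x. \<omega> c (chart_inv c x) (omit i vs)) differentiable (at (snd c p))"
  shows "ext_deriv (scale_form \<phi> \<omega>) c p vs =
    wedge1 (differential \<phi>) \<omega> c p vs + \<phi> p * ext_deriv \<omega> c p vs"
proof -
  have "frechet_derivative (\<lambda>x. scale_form \<phi> \<omega> c (chart_inv c x) (omit i vs)) (at (snd c p)) v =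
      differential \<phi> c p [v] * \<omega> c p (omit i vs)
      + \<phi> p * frechet_derivative (\<lambda>x. \<omega> c (chart_inv c x) (omit i vs)) (at (snd c p)) v"
    if "i < length vs" for i v
  proof -
    have "((\<lambda>x. (\<phi> \<circ> chart_inv c) x * \<omega> c (chart_inv c x) (omit i vs)) has_derivative
      (\<lambda>v. (\<phi> \<circ> chart_inv c) (snd c p) *
          frechet_derivative (\<lambda>x. \<omega> c (chart_inv c x) (omit i vs)) (at (snd c p)) v
        + differential \<phi> c p [v] * \<omega> c (chart_inv c (snd c p)) (omit i vs))) (at (snd c p))"
      by (rule has_derivative_mult[OF \<phi>]) (use \<omega>[OF that] in \<open>simp add: frechet_derivative_works\<close>)
    from frechet_derivative_apply[OF this, of v] show ?thesis
      by (simp add: scale_form_def chart_inv_left[OF c])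
  qed
  then show ?thesis
    unfolding ext_deriv_def wedge1_def
    by (simp add: sum_distrib_left algebra_simps flip: sum.distrib)
qed

lemma differential_exp_minus:
  assumes f: "((f \<circ> chart_inv c) has_derivative (\<lambda>v. differential f c p [v])) (at (snd c p))"
    and c: "c \<in> A" "p \<in> fst c"
  shows "(((\<lambda>p. exp (- f p)) \<circ> chart_inv c) has_derivative
      (\<lambda>v. differential (\<lambda>p. exp (- f p)) c p [v])) (at (snd c p))"
    and "differential (\<lambda>p. exp (- f p)) c p [v] = - (exp (- f p) * differential f c p [v])"
proof -
  have D: "(((\<lambda>p. exp (- f p)) \<circ> chart_inv c) has_derivative
      (\<lambda>v. - (exp (- f p) * differential f c p [v]))) (at (snd c p))"
    using has_derivative_exp[OF has_derivative_minus[OF f]]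
    by (simp add: o_def chart_inv_left[OF c] mult.commute[of "exp _"])
  from frechet_derivative_apply[OF this]
  show E: "differential (\<lambda>p. exp (- f p)) c p [v] = - (exp (- f p) * differential f c p [v])" for v
    by (simp add: differential_def)
  show "(((\<lambda>p. exp (- f p)) \<circ> chart_inv c) has_derivative
      (\<lambda>v. differential (\<lambda>p. exp (- f p)) c p [v])) (at (snd c p))"
    unfolding E by (rule D)
qed

text \<open>\<open>d(e\<^sup>-\<^sup>f \<omega>) = e\<^sup>-\<^sup>f (d\<omega> - df \<and> \<omega>)\<close>, so closedness of \<open>e\<^sup>-\<^sup>f \<omega>\<close> says \<open>d\<omega> = df \<and> \<omega>\<close>.\<close>

lemma ext_deriv_eq_wedge1_differential:
  assumes f: "smooth_function_on A W f" "openin M W" and c: "c \<in> A" "p \<in> fst c" "p \<in> W"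
    and \<omega>: "\<And>vs. length vs = k \<Longrightarrow> smooth_on (snd c ` fst c) (\<lambda>x. \<omega> c (chart_inv c x) vs)"
    and closed: "closed_form_on A k W (scale_form (\<lambda>p. exp (- f p)) \<omega>)"
    and vs: "length vs = Suc k"
  shows "ext_deriv \<omega> c p vs = wedge1 (differential f) \<omega> c p vs"
proof -
  have D: "((f \<circ> chart_inv c) has_derivative (\<lambda>v. differential f c p [v])) (at (snd c p))"
    using smooth_function_has_derivative f c by blast
  have "(\<lambda>x. \<omega> c (chart_inv c x) (omit i vs)) differentiable (at (snd c p))" if "i < length vs" for i
  proof (rule differentiableI[OF smooth_on_imp_has_derivative])
    show "smooth_on (snd c ` fst c) (\<lambda>x. \<omega> c (chart_inv c x) (omit i vs))"
      using that vs by (intro \<omega>) (simp add: omit_def)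
  qed (use open_chart_range c in auto)
  from ext_deriv_scale_form[where \<omega> = \<omega>, OF c(1,2) differential_exp_minus(1)[OF D c(1,2)] this]
  have "wedge1 (differential (\<lambda>p. exp (- f p))) \<omega> c p vs + exp (- f p) * ext_deriv \<omega> c p vs = 0"
    using closed c vs by (simp add: closed_form_on_def form_eq_on_def)
  moreover have "wedge1 (differential (\<lambda>p. exp (- f p))) \<omega> c p vs =
      - (exp (- f p) * wedge1 (differential f) \<omega> c p vs)"
    unfolding wedge1_def differential_exp_minus(2)[OF D c(1,2)]
    by (simp add: sum_distrib_left mult_ac flip: sum_negf)
  ultimately have "exp (- f p) * (ext_deriv \<omega> c p vs - wedge1 (differential f) \<omega> c p vs) = 0"
    by (simp add: algebra_simps)
  then show ?thesis by simp
qed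

end

section \<open>The torsion form of a Hermitian manifold\<close>

context
  fixes M :: "'a topology" and A :: "('a, complex ^ 'n) chart set"
    and J :: "('a, complex ^ 'n) endo_field" and g :: "('a, complex ^ 'n) cov_tensor"
  assumes herm: "hermitian_manifold M A J g"
begin

lemma smooth_mfd: "smooth_manifold M A"
  using herm by (simp add: hermitian_manifold_def)

lemma J_field: "smooth_endo_field A J"
  and J_square: "c \<in> A \<Longrightarrow> p \<in> fst c \<Longrightarrow> J c p (J c p v) = - v"
  using herm by (simp_all add: hermitian_manifold_def complex_structure_def)

lemma J_linear: "c \<in> A \<Longrightarrow> p \<in> fst c \<Longrightarrow> linear (J c p)"
  and J_transition: "c \<in> A \<Longrightarrow> c' \<in> A \<Longrightarrow> p \<in> fst c \<Longrightarrow> p \<in> fst c' \<Longrightarrow>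
    J c' p (tangent_transition c c' p v) = tangent_transition c c' p (J c p v)"
  and J_smooth: "c \<in> A \<Longrightarrow> smooth_on (snd c ` fst c) (\<lambda>x. J c (chart_inv c x) v)"
  using J_field by (simp_all add: smooth_endo_field_def)

lemma metric: "riemannian_metric A g"
  and metric_J: "c \<in> A \<Longrightarrow> p \<in> fst c \<Longrightarrow> g c p [J c p u, J c p v] = g c p [u, v]"
  using herm by (simp_all add: hermitian_manifold_def)

lemma metric_tensor: "smooth_cov_tensor A 2 g"
  and metric_commute: "c \<in> A \<Longrightarrow> p \<in> fst c \<Longrightarrow> g c p [u, v] = g c p [v, u]"
  using metric by (auto simp: riemannian_metric_def)

lemma metric_linear_left:
  assumes "c \<in> A" "p \<in> fst c"
  shows "linear (\<lambda>u. g c p [u, v])"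
proof -
  have "\<forall>vs. length vs = 2 \<longrightarrow> (\<forall>i<2. linear (\<lambda>v. g c p (vs[i := v])))"
    using metric_tensor assms by (auto simp: smooth_cov_tensor_def)
  from this[rule_format, of "[v, v]" 0] show ?thesis by simp
qed

lemma metric_transition:
  "c \<in> A \<Longrightarrow> c' \<in> A \<Longrightarrow> p \<in> fst c \<Longrightarrow> p \<in> fst c' \<Longrightarrow>
    g c' p [tangent_transition c c' p u, tangent_transition c c' p v] = g c p [u, v]"
proof -
  assume *: "c \<in> A" "c' \<in> A" "p \<in> fst c" "p \<in> fst c'"
  have "\<forall>vs. length vs = 2 \<longrightarrow> g c' p (map (tangent_transition c c' p) vs) = g c p vs"
    using metric_tensor * by (auto simp: smooth_cov_tensor_def)
  from this[rule_format, of "[u, v]"] show ?thesis by simp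
qed

lemma metric_smooth: "c \<in> A \<Longrightarrow> smooth_on (snd c ` fst c) (\<lambda>x. g c (chart_inv c x) [u, v])"
  using metric_tensor by (simp add: smooth_cov_tensor_def)

definition local_fundamental_form ::
    "('a, complex ^ 'n) chart \<Rightarrow> complex ^ 'n \<Rightarrow> complex ^ 'n \<Rightarrow> complex ^ 'n \<Rightarrow> real" where
  "local_fundamental_form c x a b = g c (chart_inv c x) [J c (chart_inv c x) a, b]"

lemma two_form_local_fundamental_form:
  assumes c: "c \<in> A"
  shows "two_form_on (snd c ` fst c) (local_fundamental_form c)"
  unfolding two_form_on_def
proof (intro conjI ballI allI)
  fix x a b assume "x \<in> snd c ` fst c"
  then have p: "chart_inv c x \<in> fst c" by (rule chart_inv_in)
  have "linear (\<lambda>v. g c (chart_inv c x) [v, J c (chart_inv c x) a])"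
    by (rule metric_linear_left[OF c p])
  then show "linear (local_fundamental_form c x a)"
    by (simp add: local_fundamental_form_def[abs_def] metric_commute[OF c p, of "J c (chart_inv c x) a"])
  have "g c (chart_inv c x) [J c (chart_inv c x) a, b]
      = g c (chart_inv c x) [- a, J c (chart_inv c x) b]"
    using metric_J[OF c p, of "J c (chart_inv c x) a" b] by (simp add: J_square[OF c p])
  also have "\<dots> = - g c (chart_inv c x) [a, J c (chart_inv c x) b]"
    by (rule linear_neg[OF metric_linear_left[OF c p]])
  also have "\<dots> = - g c (chart_inv c x) [J c (chart_inv c x) b, a]"
    by (simp only: metric_commute[OF c p, of a])
  finally show "local_fundamental_form c x a b = - local_fundamental_form c x b a"
    by (simp add: local_fundamental_form_def)
next
  fix a b
  show "smooth_on (snd c ` fst c) (\<lambda>x. local_fundamental_form c x a b)"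
    unfolding local_fundamental_form_def
    by (rule smooth_on_linear_apply[OF open_chart_range[OF smooth_mfd c], where v = "\<lambda>x. J c (chart_inv c x) a"
          and T = "\<lambda>x u. g c (chart_inv c x) [u, b]"])
       (intro metric_linear_left metric_smooth J_smooth chart_inv_in c; assumption)+
qed

lemma torsion_form_eq_ext_deriv2:
  "torsion_form J g c p [u, v, w] =
     - ext_deriv2 (local_fundamental_form c) (snd c p) (J c p u) (J c p v) (J c p w)"
  by (simp add: torsion_form_def ext_deriv_def ext_deriv2_def fundamental_form_def
      local_fundamental_form_def lessThan_Suc omit_def numeral_2_eq_2 algebra_simps)

lemma list_of_length_3:
  assumes "length vs = 3"
  obtains u v w where "vs = [u, v, w]"
  using assms by (auto simp: numeral_3_eq_3 length_Suc_conv)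

lemma smooth_on_torsion_form:
  assumes c: "c \<in> A" and vs: "length vs = 3"
  shows "smooth_on (snd c ` fst c) (\<lambda>x. torsion_form J g c (chart_inv c x) vs)"
proof -
  obtain u v w where vs: "vs = [u, v, w]" using vs by (rule list_of_length_3)
  note S = open_chart_range[OF smooth_mfd c]
  let ?J = "\<lambda>v x. J c (chart_inv c x) v"
  have "smooth_on (snd c ` fst c) (\<lambda>x. - ext_deriv2 (local_fundamental_form c) x (?J u x) (?J v x) (?J w x))"
    by (intro smooth_on_minus[OF S] smooth_on_ext_deriv2[OF S two_form_local_fundamental_form[OF c]] J_smooth c)
  then show ?thesis
    by (rule smooth_on_cong[OF S]) (simp add: vs torsion_form_eq_ext_deriv2 chart_inv_right)
qed

lemma torsion_form_skew:
  assumes "c \<in> A" "p \<in> fst c"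
  shows "torsion_form J g c p [u, v, w] = - torsion_form J g c p [v, u, w]"
    and "torsion_form J g c p [u, v, w] = - torsion_form J g c p [u, w, v]"
proof -
  have "snd c p \<in> snd c ` fst c" using assms by simp
  note skew = ext_deriv2_skew[OF open_chart_range[OF smooth_mfd assms(1)] two_form_local_fundamental_form[OF assms(1)] this]
  show "torsion_form J g c p [u, v, w] = - torsion_form J g c p [v, u, w]"
    unfolding torsion_form_eq_ext_deriv2 by (rule arg_cong[OF skew(1)])
  show "torsion_form J g c p [u, v, w] = - torsion_form J g c p [u, w, v]"
    unfolding torsion_form_eq_ext_deriv2 by (rule arg_cong[OF skew(2)])
qed

lemma torsion_form_linear:
  assumes "c \<in> A" "p \<in> fst c"
  shows "linear (\<lambda>w. torsion_form J g c p [u, v, w])"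
    and "linear (\<lambda>u. torsion_form J g c p [u, v, w])"
proof -
  have x: "snd c p \<in> snd c ` fst c" using assms by simp
  show last: "linear (\<lambda>w. torsion_form J g c p [u, v, w])" for u v
    unfolding torsion_form_eq_ext_deriv2
    using linear_compose_neg[OF linear_compose[OF J_linear[OF assms]
        ext_deriv2_linear[OF open_chart_range[OF smooth_mfd assms(1)] two_form_local_fundamental_form[OF assms(1)] x]]]
    by (simp add: o_def)
  have "torsion_form J g c p [u, v, w] = torsion_form J g c p [v, w, u]" for u
    using torsion_form_skew(1)[OF assms, of u v w] torsion_form_skew(2)[OF assms, of v u w] by simp
  then show "linear (\<lambda>u. torsion_form J g c p [u, v, w])"
    using last[of v w] by simp
qed

text \<open>\<open>d\<Omega>\<close> transforms like a tensor because \<open>d\<close> commutes with the change of coordinates, and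
  \<open>J\<close> commutes with its Jacobian.\<close>

lemma torsion_form_transition:
  assumes c: "c \<in> A" "c' \<in> A" and p: "p \<in> fst c" "p \<in> fst c'"
  shows "torsion_form J g c' p [tangent_transition c c' p u, tangent_transition c c' p v,
      tangent_transition c c' p w] = torsion_form J g c p [u, v, w]"
proof -
  let ?R = "snd c ` (fst c \<inter> fst c')"
  have "ext_deriv2 (local_fundamental_form c) (snd c p) a b d =
      ext_deriv2 (local_fundamental_form c') (transition c c' (snd c p)) (tangent_transition c c' p a)
        (tangent_transition c c' p b) (tangent_transition c c' p d)" for a b d
    unfolding tangent_transition_def
  proof (rule ext_deriv2_pullback[OF open_chart_range[OF smooth_mfd c(2)] two_form_local_fundamental_form[OF c(2)]])
    show "open ?R" by (rule open_chart_overlap[OF smooth_mfd c])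
    show "snd c p \<in> ?R" using p by auto
    show "smooth_on ?R (transition c c')" by (rule smooth_on_transition[OF smooth_mfd c])
    show "transition c c' ` ?R \<subseteq> snd c' ` fst c'" using c by (auto simp: transition_chart[OF smooth_mfd])
    fix y a b assume "y \<in> ?R"
    then obtain q where q: "q \<in> fst c" "q \<in> fst c'" "y = snd c q" by auto
    show "local_fundamental_form c y a b = local_fundamental_form c' (transition c c' y)
        (frechet_derivative (transition c c') (at y) a) (frechet_derivative (transition c c') (at y) b)"
      using metric_transition[OF c q(1,2)] J_transition[OF c q(1,2)] q(3)
      by (simp add: local_fundamental_form_def transition_chart[OF smooth_mfd c(1) q(1)]
          chart_inv_left[OF smooth_mfd c(1) q(1)] chart_inv_left[OF smooth_mfd c(2) q(2)]
          flip: tangent_transition_def)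
  qed
  then show ?thesis
    by (simp add: torsion_form_eq_ext_deriv2 J_transition[OF c p] transition_chart[OF smooth_mfd c(1) p(1)])
qed

section \<open>The local potentials have the same differential\<close>

text \<open>Non-degeneracy speaks of global smooth fields, while the hypothesis here gives kernel vectors
  chosen separately at each point. Elimination turns them into a smooth field on a smaller open set,
  and a bump function makes it global. The transformation law of \<open>H\<close> is needed to recognise the
  extended field as an element of the kernel in every other chart.\<close>

lemma torsion_form_kernel_field:
  assumes c: "c \<in> A" and Q: "open Q" "Q \<noteq> {}" "Q \<subseteq> snd c ` fst c"
    and deg: "\<And>x. x \<in> Q \<Longrightarrow> \<exists>v. v \<noteq> 0 \<and> (\<forall>a b. torsion_form J g c (chart_inv c x) [v, a, b] = 0)"
  shows "\<not> nondegenerate_form M A 3 (torsion_form J g)"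
proof -
  let ?H = "\<lambda>x v a b. torsion_form J g c (chart_inv c x) [v, a, b]"
  have lin: "linear (\<lambda>v. ?H x v a b)" if "x \<in> Q" for x a b
    using that Q(3) by (intro torsion_form_linear(2)[OF c] chart_inv_in) auto
  obtain T k where T: "open T" "T \<noteq> {}" "T \<subseteq> Q"
    and k: "\<And>b. b \<in> Basis \<Longrightarrow> smooth_on T (k b)" "\<And>x. x \<in> T \<Longrightarrow> \<exists>b\<in>Basis. k b x \<noteq> (0::real)"
      "\<And>x ab. x \<in> T \<Longrightarrow> (\<Sum>v\<in>Basis. k v x * ?H x v (fst ab) (snd ab)) = 0"
  proof (rule smooth_linear_dependence[OF finite_Basis Q(1,2),
        of "\<lambda>v ab x. ?H x v (fst ab) (snd ab)"])
    show "smooth_on Q (\<lambda>x. ?H x v (fst ab) (snd ab))" for v ab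
      by (rule smooth_on_subset[OF smooth_on_torsion_form[OF c] Q(3)]) simp
    fix x assume x: "x \<in> Q"
    then obtain v where v: "v \<noteq> 0" "\<And>a b. ?H x v a b = 0" using deg by blast
    have "(\<Sum>i\<in>Basis. (v \<bullet> i) * ?H x i a b) = 0" for a b
      using linear_eq_sum_Basis[OF lin[OF x], of v a b] v(2) by simp
    moreover have "\<exists>i\<in>Basis. v \<bullet> i \<noteq> 0" using v(1) by (metis euclidean_all_zero_iff)
    ultimately show "\<exists>k. (\<exists>i\<in>Basis. k i \<noteq> 0) \<and>
        (\<forall>ab. (\<Sum>i\<in>Basis. k i * ?H x i (fst ab) (snd ab)) = 0)"
      by (intro exI[of _ "\<lambda>i. v \<bullet> i"]) simp
  qed blast
  \<comment> \<open>the coefficients of the relation are the components of a kernel vector\<close>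
  define Y where "Y x = (\<Sum>i\<in>Basis. k i x *\<^sub>R i)" for x
  have Y_smooth: "smooth_on T Y"
    unfolding Y_def by (intro smooth_on_sum smooth_on_scaleR smooth_on_const k T(1))
  have Y_kernel: "?H x (Y x) a b = 0" if "x \<in> T" for x a b
  proof -
    have x: "x \<in> Q" using that T(3) by blast
    show ?thesis
      unfolding Y_def using k(3)[OF that, of "(a, b)"]
      by (simp add: linear_sum[OF lin[OF x]] linear_cmul[OF lin[OF x]])
  qed
  obtain x1 where x1: "x1 \<in> T" using T(2) by blast
  obtain i where "i \<in> Basis" "k i x1 \<noteq> 0" using k(2)[OF x1] by blast
  moreover have "Y x1 \<bullet> i = k i x1" if "i \<in> Basis"
    unfolding Y_def using that by simp
  ultimately have Y_nonzero: "Y x1 \<noteq> 0" by auto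
  obtain r where r: "r > 0" "cball x1 r \<subseteq> T" using T(1) x1 open_contains_cball by blast
  obtain \<rho> :: "complex ^ 'n \<Rightarrow> real" where \<rho>: "smooth_on UNIV \<rho>" "\<rho> x1 \<noteq> 0" "\<And>x. x \<notin> cball x1 r \<Longrightarrow> \<rho> x = 0"
    by (rule smooth_bump_exists[OF r(1), of x1]) (rule that)
  define Z where "Z x = (if x \<in> T then \<rho> x *\<^sub>R Y x else 0)" for x
  have Z_out: "Z x = 0" if "x \<notin> cball x1 r" for x
    using \<rho>(3)[OF that] by (simp add: Z_def)
  have S: "open (snd c ` fst c)" by (rule open_chart_range[OF smooth_mfd c])
  have Z: "smooth_on (snd c ` fst c) Z"
  proof (rule smooth_on_local[OF S])
    fix x assume "x \<in> snd c ` fst c"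
    show "\<exists>T. open T \<and> x \<in> T \<and> smooth_on T Z"
    proof (cases "x \<in> T")
      case True
      have "smooth_on T (\<lambda>x. \<rho> x *\<^sub>R Y x)"
        by (intro smooth_on_scaleR T(1) Y_smooth smooth_on_subset[OF \<rho>(1)]) simp
      then have "smooth_on T Z" by (rule smooth_on_cong[OF T(1)]) (simp add: Z_def)
      then show ?thesis using True T(1) by blast
    next
      case False
      have o: "open (- cball x1 r)" by (rule open_Compl[OF closed_cball])
      have "smooth_on (- cball x1 r) Z"
        by (rule smooth_on_cong[OF o smooth_on_const[OF o, of 0]]) (simp add: Z_out)
      then show ?thesis using False r(2) o by blast
    qed
  qed
  define X where "X = extend_by_zero c Z"
  have X_field: "smooth_vector_field A X"
    unfolding X_def
    by (rule smooth_vector_field_extend_by_zero[OF smooth_mfd c Z compact_cball])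
       (use r(2) T(3) Q(3) Z_out in auto)
  have Z_kernel: "torsion_form J g c p [Z (snd c p), a, b] = 0" if p: "p \<in> fst c" for p a b
  proof -
    note l = torsion_form_linear(2)[OF c p]
    show ?thesis
      using Y_kernel[of "snd c p"] linear_0[OF l] linear_cmul[OF l]
      by (simp add: Z_def chart_inv_left[OF smooth_mfd c p])
  qed
  have "torsion_form J g c' p [X c' p, a, b] = 0" if c': "c' \<in> A" and p: "p \<in> fst c'" for c' p a b
  proof (cases "p \<in> fst c")
    case True
    have inv: "tangent_transition c c' p (tangent_transition c' c p v) = v" for v
      using tangent_transition_cocycle[OF smooth_mfd c' c c' p True p]
        tangent_transition_self[OF smooth_mfd c' p] by simp
    show ?thesis
      using torsion_form_transition[OF c c' True p, of "Z (snd c p)" "tangent_transition c' c p a"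
          "tangent_transition c' c p b"] Z_kernel[OF True] True
      by (simp add: inv X_def extend_by_zero_def)
  next
    case False
    then show ?thesis
      using linear_0[OF torsion_form_linear(2)[OF c' p]] by (simp add: X_def extend_by_zero_def)
  qed
  then have "X \<in> form_kernel M A 3 (torsion_form J g)"
    using X_field
    by (auto simp: form_kernel_def form_eq_on_def interior_prod_def numeral_2_eq_2 length_Suc_conv)
  moreover define p1 where "p1 = chart_inv c x1"
  have x1_range: "x1 \<in> snd c ` fst c" using x1 T Q by blast
  have p1: "p1 \<in> fst c" unfolding p1_def by (rule chart_inv_in[OF x1_range])
  have "X c p1 = Z x1"
    using p1 chart_inv_right[OF x1_range] tangent_transition_self[OF smooth_mfd c p1]
    by (simp add: X_def extend_by_zero_def p1_def)
  then have "X c p1 \<noteq> 0" using x1 Y_nonzero \<rho>(2) by (simp add: Z_def)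
  ultimately show ?thesis
    using c p1 unfolding nondegenerate_form_def by blast
qed

lemma wedge1_three_form_expand:
  "wedge1 \<alpha> \<omega> c p [a, b, d, e] = \<alpha> c p [a] * \<omega> c p [b, d, e] - \<alpha> c p [b] * \<omega> c p [a, d, e]
     + \<alpha> c p [d] * \<omega> c p [a, b, e] - \<alpha> c p [e] * \<omega> c p [a, b, d]"
  by (simp add: wedge1_def omit_def lessThan_Suc numeral_2_eq_2 algebra_simps)

text \<open>On the overlap \<open>dH = df \<and> H = df' \<and> H\<close>, so \<open>\<beta> = df - df'\<close> satisfies \<open>\<beta> \<and> H = 0\<close>. Where
  \<open>\<beta>\<close> does not vanish, which is an open condition, \<open>H\<close> has a non-trivial kernel because the real
  dimension is even.\<close>

lemma differentials_agree:
  assumes nondeg: "nondegenerate_form M A 3 (torsion_form J g)"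
    and f: "smooth_function_on A W f" "openin M W"
      "closed_form_on A 3 W (scale_form (\<lambda>p. exp (- f p)) (torsion_form J g))"
    and f': "smooth_function_on A W' f'" "openin M W'"
      "closed_form_on A 3 W' (scale_form (\<lambda>p. exp (- f' p)) (torsion_form J g))"
    and c: "c \<in> A" "p \<in> fst c" "p \<in> W" "p \<in> W'"
  shows "differential f c p [n] = differential f' c p [n]"
proof (rule ccontr)
  assume ne: "differential f c p [n] \<noteq> differential f' c p [n]"
  let ?V = "W \<inter> W'"
  define S where "S = snd c ` (fst c \<inter> ?V)"
  have S: "open S" unfolding S_def by (rule chart_open_image[OF smooth_mfd c(1) openin_Int[OF f(2) f'(2)]])
  define \<beta> where "\<beta> x v = differential f c (chart_inv c x) [v] - differential f' c (chart_inv c x) [v]" for x v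
  have smooth: "smooth_on S (\<lambda>x. differential h c (chart_inv c x) [v])"
    if h: "smooth_function_on A V h" "?V \<subseteq> V" for h V v
  proof (rule smooth_on_cong[OF S])
    have "smooth_on (snd c ` (fst c \<inter> V)) (h \<circ> chart_inv c)"
      using h c by (simp add: smooth_function_on_def)
    then have "smooth_on S (h \<circ> chart_inv c)"
      by (rule smooth_on_subset) (use h in \<open>auto simp: S_def\<close>)
    then show "smooth_on S (\<lambda>x. frechet_derivative (h \<circ> chart_inv c) (at x) v)"
      by (rule smooth_on_frechet_derivative)
    show "frechet_derivative (h \<circ> chart_inv c) (at x) v = differential h c (chart_inv c x) [v]"
      if "x \<in> S" for x
      using that c by (auto simp: S_def differential_def chart_inv_left[OF smooth_mfd])
  qed
  have "smooth_on S (\<lambda>x. \<beta> x n)"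
    unfolding \<beta>_def by (intro smooth_on_diff S smooth[OF f(1)] smooth[OF f'(1)]) auto
  then have cont: "continuous_on S (\<lambda>x. \<beta> x n)" by (rule smooth_on_imp_continuous_on)
  define Q where "Q = S \<inter> (\<lambda>x. \<beta> x n) -` (- {0})"
  show False
  proof (rule notE[OF torsion_form_kernel_field nondeg, OF c(1)])
    show "open Q" unfolding Q_def by (rule continuous_open_preimage[OF cont S open_Compl[OF closed_singleton]])
    have "snd c p \<in> Q"
      using ne c by (auto simp: Q_def S_def \<beta>_def chart_inv_left[OF smooth_mfd])
    then show "Q \<noteq> {}" by blast
    show "Q \<subseteq> snd c ` fst c" by (auto simp: Q_def S_def)
    fix x assume "x \<in> Q"
    then obtain q where q: "q \<in> fst c" "q \<in> W" "q \<in> W'" "x = snd c q" and \<beta>n: "\<beta> x n \<noteq> 0"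
      by (auto simp: Q_def S_def)
    have qx: "chart_inv c x = q" using q c by (simp add: chart_inv_left[OF smooth_mfd])
    have D: "linear (\<lambda>v. differential h c q [v])" if "smooth_function_on A V h" "openin M V" "q \<in> V" for h V
      by (rule has_derivative_linear[OF smooth_function_has_derivative[OF smooth_mfd that(1,2) c(1) q(1) that(3)]])
    have "linear (\<beta> x)"
      unfolding \<beta>_def[abs_def] qx by (intro linear_compose_sub D[OF f(1,2) q(2)] D[OF f'(1,2) q(3)])
    moreover have "\<beta> x a * torsion_form J g c q [b, d, e] - \<beta> x b * torsion_form J g c q [a, d, e]
        + \<beta> x d * torsion_form J g c q [a, b, e] - \<beta> x e * torsion_form J g c q [a, b, d] = 0"
      for a b d e
    proof -
      have "wedge1 (differential f) (torsion_form J g) c q [a, b, d, e] =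
          wedge1 (differential f') (torsion_form J g) c q [a, b, d, e]"
        using ext_deriv_eq_wedge1_differential[OF smooth_mfd f(1,2) c(1) q(1,2) smooth_on_torsion_form[OF c(1)] f(3)]
          ext_deriv_eq_wedge1_differential[OF smooth_mfd f'(1,2) c(1) q(1,3) smooth_on_torsion_form[OF c(1)] f'(3)]
        by simp
      then show ?thesis
        unfolding wedge1_three_form_expand \<beta>_def qx by (simp add: algebra_simps)
    qed
    moreover have "even (DIM(complex ^ 'n))" by simp
    ultimately obtain v where "v \<noteq> 0" "\<And>b d. torsion_form J g c q [v, b, d] = 0"
      using degenerate_3form_if_divisible[where H = "\<lambda>a b d. torsion_form J g c q [a, b, d]" and \<beta> = "\<beta> x" and n = n]
        \<beta>n torsion_form_linear(1)[OF c(1) q(1)] torsion_form_skew[OF c(1) q(1)] by blast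
    then show "\<exists>v. v \<noteq> 0 \<and> (\<forall>a b. torsion_form J g c (chart_inv c x) [v, a, b] = 0)"
      unfolding qx by blast
  qed
qed

end

section \<open>Gluing the differentials\<close>

text \<open>Near each point the form is the differential of a single function, so its closedness is the
  symmetry of the second derivatives of that function.\<close>

lemma glued_differentials_closed_form:
  fixes M :: "'a topology" and A :: "('a, 'e::euclidean_space) chart set"
  assumes mfd: "smooth_manifold M A"
    and U: "\<And>i. i \<in> I \<Longrightarrow> openin M (U i)" "(\<Union>i\<in>I. U i) = topspace M"
    and f: "\<And>i. i \<in> I \<Longrightarrow> smooth_function_on A (U i) (f i)"
    and agree: "\<And>i j c p v. i \<in> I \<Longrightarrow> j \<in> I \<Longrightarrow> c \<in> A \<Longrightarrow> p \<in> fst c \<Longrightarrow> p \<in> U i \<Longrightarrow> p \<in> U j \<Longrightarrow>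
      differential (f i) c p [v] = differential (f j) c p [v]"
  obtains \<alpha> where "diff_form A 1 \<alpha>" "closed_form_on A 1 (topspace M) \<alpha>"
    "\<And>i c p v. i \<in> I \<Longrightarrow> c \<in> A \<Longrightarrow> p \<in> fst c \<Longrightarrow> p \<in> U i \<Longrightarrow> \<alpha> c p [v] = differential (f i) c p [v]"
proof -
  define idx where "idx p = (SOME i. i \<in> I \<and> p \<in> U i)" for p
  define \<alpha> :: "('a, 'e) cov_tensor" where "\<alpha> c p vs = differential (f (idx p)) c p vs" for c p vs
  have idx: "idx p \<in> I \<and> p \<in> U (idx p)" if "i \<in> I" "p \<in> U i" for i p
    unfolding idx_def using that by (intro someI[of "\<lambda>i. i \<in> I \<and> p \<in> U i" i]) simp
  have \<alpha>: "\<alpha> c p [v] = differential (f i) c p [v]"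
    if "i \<in> I" "c \<in> A" "p \<in> fst c" "p \<in> U i" for i c p v
    unfolding \<alpha>_def using idx[OF that(1,4)] that by (intro agree) auto
  have cover: "\<exists>i\<in>I. p \<in> U i" if "c \<in> A" "p \<in> fst c" for c p
    using chart_domain_subset[OF mfd that(1)] that(2) U(2) by blast
  have local_\<alpha>: "\<exists>i S. i \<in> I \<and> p \<in> U i \<and> open S \<and> snd c p \<in> S \<and> smooth_on S (f i \<circ> chart_inv c) \<and>
      (\<forall>y\<in>S. \<forall>v. frechet_derivative (f i \<circ> chart_inv c) (at y) v = \<alpha> c (chart_inv c y) [v])"
    if c: "c \<in> A" "p \<in> fst c" for c p
  proof -
    obtain i where i: "i \<in> I" "p \<in> U i" using cover[OF c] by blast
    let ?S = "snd c ` (fst c \<inter> U i)"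
    have "smooth_on ?S (f i \<circ> chart_inv c)"
      using f[OF i(1)] c by (simp add: smooth_function_on_def)
    moreover have "frechet_derivative (f i \<circ> chart_inv c) (at y) v = \<alpha> c (chart_inv c y) [v]"
      if "y \<in> ?S" for y v
    proof -
      obtain q where q: "q \<in> fst c" "q \<in> U i" "y = snd c q" using \<open>y \<in> ?S\<close> by auto
      then have "\<alpha> c (chart_inv c y) [v] = differential (f i) c q [v]"
        using \<alpha>[OF i(1) c(1) q(1,2)] by (simp add: chart_inv_left[OF mfd c(1)])
      then show ?thesis by (simp add: differential_def q(3))
    qed
    moreover have "open ?S" by (rule chart_open_image[OF mfd c(1) U(1)[OF i(1)]])
    moreover have "snd c p \<in> ?S" using c i by auto
    ultimately show ?thesis using i by blast
  qed
  have tensor: "smooth_cov_tensor A 1 \<alpha>"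
    unfolding smooth_cov_tensor_def
  proof (intro conjI ballI allI impI)
    fix c p and vs :: "'e list" and k :: nat
    assume c: "c \<in> A" "p \<in> fst c" and vs: "length vs = 1" "k < 1"
    obtain u where u: "vs = [u]" using vs(1) by (auto simp: length_Suc_conv)
    obtain i where i: "i \<in> I" "p \<in> U i" using cover[OF c] by blast
    have "linear (\<lambda>v. differential (f i) c p [v])"
      by (rule has_derivative_linear[OF smooth_function_has_derivative[OF mfd f U(1)]])
         (use c i in auto)
    then show "linear (\<lambda>v. \<alpha> c p (vs[k := v]))"
      using vs(2) by (simp add: u \<alpha>[OF i(1) c i(2)])
  next
    fix c c' p and vs :: "'e list"
    assume c: "c \<in> A" "c' \<in> A" and p: "p \<in> fst c \<inter> fst c'" and vs: "length vs = 1"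
    obtain u where u: "vs = [u]" using vs by (auto simp: length_Suc_conv)
    have pc: "p \<in> fst c" "p \<in> fst c'" using p by auto
    obtain i where i: "i \<in> I" "p \<in> U i" using cover[OF c(1) pc(1)] by blast
    show "\<alpha> c' p (map (tangent_transition c c' p) vs) = \<alpha> c p vs"
      using differential_tangent_transition[OF mfd f[OF i(1)] U(1)[OF i(1)] c pc i(2)]
      by (simp add: u \<alpha>[OF i(1) c(1) pc(1) i(2)] \<alpha>[OF i(1) c(2) pc(2) i(2)])
  next
    fix c and vs :: "'e list"
    assume c: "c \<in> A" and vs: "length vs = 1"
    obtain u where u: "vs = [u]" using vs by (auto simp: length_Suc_conv)
    show "smooth_on (snd c ` fst c) (\<lambda>x. \<alpha> c (chart_inv c x) vs)"
    proof (rule smooth_on_local[OF open_chart_range[OF mfd c]])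
      fix x assume "x \<in> snd c ` fst c"
      then obtain p where p: "p \<in> fst c" "x = snd c p" by auto
      obtain i S where S: "open S" "snd c p \<in> S" "smooth_on S (f i \<circ> chart_inv c)"
        "\<forall>y\<in>S. \<forall>v. frechet_derivative (f i \<circ> chart_inv c) (at y) v = \<alpha> c (chart_inv c y) [v]"
        using local_\<alpha>[OF c p(1)] by blast
      have "smooth_on S (\<lambda>x. \<alpha> c (chart_inv c x) vs)"
        by (rule smooth_on_cong[OF S(1) smooth_on_frechet_derivative[OF S(3), of u]])
           (simp add: S(4) u)
      then show "\<exists>T. open T \<and> x \<in> T \<and> smooth_on T (\<lambda>x. \<alpha> c (chart_inv c x) vs)"
        using S p by blast
    qed
  qed
  have "closed_form_on A 1 (topspace M) \<alpha>"
    unfolding closed_form_on_def form_eq_on_def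
  proof (intro ballI allI impI)
    fix c p and vs :: "'e list"
    assume c: "c \<in> A" and "p \<in> fst c \<inter> topspace M" and vs: "length vs = Suc 1"
    then have p: "p \<in> fst c" by simp
    obtain u v where uv: "vs = [u, v]" using vs by (auto simp: length_Suc_conv)
    obtain i S where S: "open S" "snd c p \<in> S" "smooth_on S (f i \<circ> chart_inv c)"
      "\<forall>y\<in>S. \<forall>v. frechet_derivative (f i \<circ> chart_inv c) (at y) v = \<alpha> c (chart_inv c y) [v]"
      using local_\<alpha>[OF c p] by blast
    let ?DD = "\<lambda>v w. frechet_derivative (\<lambda>y. frechet_derivative (f i \<circ> chart_inv c) (at y) v) (at (snd c p)) w"
    have D: "frechet_derivative (\<lambda>x. \<alpha> c (chart_inv c x) [v]) (at (snd c p)) w = ?DD v w" for v w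
    proof (rule frechet_derivative_apply, rule has_derivative_transform_within_open[OF _ S(1,2)])
      show "((\<lambda>y. frechet_derivative (f i \<circ> chart_inv c) (at y) v) has_derivative ?DD v) (at (snd c p))"
        by (rule smooth_on_imp_has_derivative[OF smooth_on_frechet_derivative[OF S(3)] S(1,2)])
    qed (use S(4) in blast)
    have "ext_deriv \<alpha> c p vs = ?DD v u - ?DD u v"
      by (simp add: ext_deriv_def uv omit_def lessThan_Suc D)
    also have "\<dots> = 0"
      using second_derivative_symmetric[OF S(3,1,2)] by simp
    finally show "ext_deriv \<alpha> c p vs = 0" .
  qed
  moreover have "diff_form A 1 \<alpha>"
    using tensor by (auto simp: diff_form_def)
  ultimately show thesis using \<alpha> that by blast
qed

theorem proposition2p2:
  fixes M :: "'a topology"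
    and A :: "('a, complex ^ 'n) chart set"
    and J :: "('a, complex ^ 'n) endo_field"
    and g :: "('a, complex ^ 'n) cov_tensor"
    and I :: "'i set"
    and U :: "'i \<Rightarrow> 'a set"
    and f :: "'i \<Rightarrow> 'a \<Rightarrow> real"
  assumes "hermitian_manifold M A J g"
    and "nondegenerate_form M A 3 (torsion_form J g)"
    and "\<And>i. i \<in> I \<Longrightarrow> openin M (U i)"
    and "(\<Union>i\<in>I. U i) = topspace M"
    and "\<And>i. i \<in> I \<Longrightarrow> smooth_function_on A (U i) (f i)"
    and "\<And>i. i \<in> I \<Longrightarrow>
           closed_form_on A 3 (U i) (scale_form (\<lambda>p. exp (- f i p)) (torsion_form J g))"
  shows "LCSKT M A J g"
proof -
  note mfd = smooth_mfd[OF assms(1)]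
  have agree: "differential (f i) c p [v] = differential (f j) c p [v]"
    if "i \<in> I" "j \<in> I" "c \<in> A" "p \<in> fst c" "p \<in> U i" "p \<in> U j" for i j c p v
    by (rule differentials_agree[OF assms(1,2) assms(5,3,6)[OF that(1)] assms(5,3,6)[OF that(2)] that(3-6)])
  obtain \<alpha> where \<alpha>: "diff_form A 1 \<alpha>" "closed_form_on A 1 (topspace M) \<alpha>"
    and eq: "\<And>i c p v. i \<in> I \<Longrightarrow> c \<in> A \<Longrightarrow> p \<in> fst c \<Longrightarrow> p \<in> U i \<Longrightarrow>
      \<alpha> c p [v] = differential (f i) c p [v]"
    by (rule glued_differentials_closed_form[OF mfd assms(3,4,5) agree]) (assumption | rule that)+
  have "form_eq_on A 4 (topspace M) (ext_deriv (torsion_form J g)) (wedge1 \<alpha> (torsion_form J g))"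
    unfolding form_eq_on_def
  proof (intro ballI allI impI)
    fix c p and vs :: "(complex ^ 'n) list"
    assume c: "c \<in> A" and p: "p \<in> fst c \<inter> topspace M" and vs: "length vs = 4"
    obtain i where i: "i \<in> I" "p \<in> U i" using p assms(4) by blast
    have "ext_deriv (torsion_form J g) c p vs = wedge1 (differential (f i)) (torsion_form J g) c p vs"
      using ext_deriv_eq_wedge1_differential[OF mfd assms(5,3)[OF i(1)] c _ i(2)
          smooth_on_torsion_form[OF assms(1) c] assms(6)[OF i(1)]] p vs by simp
    also have "\<dots> = wedge1 \<alpha> (torsion_form J g) c p vs"
      unfolding wedge1_def using eq[OF i(1) c _ i(2)] p by simp
    finally show "ext_deriv (torsion_form J g) c p vs = wedge1 \<alpha> (torsion_form J g) c p vs" .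
  qed
  then show ?thesis
    unfolding LCSKT_def using assms(1) \<alpha> by blast
qed

end
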